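(* Let $(A,B,\alpha)$ be a crossed module in $\mathsf{C}$ and let $(G,s_G,t_G)$ be the corresponding cat$^1$-group with operations. Then the category of covering morphisms of crossed modules over $(A,B,\alpha)$ and the category of covering morphisms of cat$^1$-groups with operations over $(G,s_G,t_G)$ are equivalent.
   Context: Groups with operations. $\mathsf{C}$ is a fixed category of groups with operations: its objects are the algebras with a set $\Omega$ of operations satisfying a set $\mathsf{E}$ of identities, where $\mathsf{E}$ includes the group laws and, with $\Omega_i$ the set of $i$-ary operations: (a) $\Omega=\Omega_0\cup\Omega_1\cup\Omega_2$; (b) the group operations $0,-,+$ (written additively, $+$ not necessarily commutative) belong to $\Omega_0,\Omega_1,\Omega_2$ respectively, $\Omega_0=\{0\}$, and with $\Omega_1'=\Omega_1\setminus\{-\}$, $\Omega_2'=\Omega_2\setminus\{+\}$, if $\star\in\Omega_2'$ then the operation $a\star^{\circ}b=b\star a$ is also in $\Omega_2'$; (c) for each $\star\in\Omega_2'$, $\mathsf{E}$ includes $a\star(b+c)=a\star b+a\star c$; (d) for $\omega\in\Omega_1'$, $\star\in\Omega_2'$, $\mathsf{E}$ includes $\omega(a+b)=\omega(a)+\omega(b)$ and $\omega(a)\star b=\omega(a\star b)$. Morphisms are group homomorphisms preserving all operations in $\Omega_1'$ and $\Omega_2'$. Derived actions. Derived actions of $B$ on $A$ (objects of $\mathsf{C}$) are the maps $b\cdot a=s(b)+a-s(b)$ and $b\star a=s(b)\star a$ ($\star\in\Omega_2'$) obtained from a split extension $0\to A\to E\xrightarrow{p}B\to 0$ in $\mathsf{C}$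 ($p$ surjective, $A=\ker p$, $s\colon B\to E$ a morphism with $ps=\mathrm{id}_B$). One writes $a\star b:=b\star^{\circ}a$. The semidirect product $A\rtimes B$ is the set $A\times B$ with $(a',b')+(a,b)=(a'+b'\cdot a,\,b'+b)$, $(a',b')\star(a,b)=(a'\star a+a'\star b+b'\star a,\,b'\star b)$, $\omega(a,b)=(\omega(a),\omega(b))$ for $\omega\in\Omega_1'$; it is an object of $\mathsf{C}$. Crossed modules. A crossed module $(A,B,\alpha)$ in $\mathsf{C}$ consists of objects $A,B$, derived actions of $B$ on $A$, and a morphism $\alpha\colon A\to B$ such that for all $b\in B$, $a,a'\in A$, $\star\in\Omega_2'$: $\alpha(b\cdot a)=b+\alpha(a)-b$; $\alpha(a)\cdot a'=a+a'-a$; $\alpha(a)\star a'=a\star a'$; $\alpha(b\star a)=b\star\alpha(a)$ and $\alpha(a\star b)=\alpha(a)\star b$. A morphism $(A,B,\alpha)\to(A',B',\alpha')$ is a pair of morphisms $f\colon A\to A'$, $g\colon B\to B'$ in $\mathsf{C}$ with $g\alpha=\alpha'f$, $f(b\cdot a)=g(b)\cdot f(a)$, $f(b\star a)=g(b)\star f(a)$. A morphism $(f,g)\colon(\widetilde A,\widetilde B,\tilde\alpha)\to(A,B,\alpha)$ is a covering morphism if $f\colon\widetilde A\to A$ is an isomorphism in $\mathsf{C}$. Cat$^1$-groups with operations. A cat$^1$-group with operations is a triple $(G,s,t)$ with $G$ an object of $\mathsf{C}$ and $s,t$ endomorphisms of $G$ in $\mathsf{C}$ such that $st=t$, $ts=s$,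 elements of $\ker s$ and $\ker t$ commute under $+$, and $x\star y=0$ for $x\in\ker s$, $y\in\ker t$, $\star\in\Omega_2'$. A morphism $(G,s,t)\to(G',s',t')$ is a morphism $f\colon G\to G'$ in $\mathsf{C}$ with $fs=s'f$, $ft=t'f$. A morphism $p\colon(\widetilde G,s_{\widetilde G},t_{\widetilde G})\to(G,s_G,t_G)$ is a covering morphism if its restriction $\ker s_{\widetilde G}\to\ker s_G$ is an isomorphism in $\mathsf{C}$. The cat$^1$-group with operations corresponding to a crossed module $(A,B,\alpha)$ is $(A\rtimes B,s,t)$ with $s(a,b)=(0,b)$ and $t(a,b)=(0,\alpha(a)+b)$. The category of covering morphisms over a fixed object $X$ has as objects the covering morphisms with codomain $X$ and as morphisms the morphisms between their domains commuting with the covering morphisms. *)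

theory Defs
  imports "HOL-Library.FuncSet"
begin

section \<open>Groups with operations\<close>

text \<open>The constructors \<open>TZero\<close>, \<open>TNeg\<close>, \<open>TAdd\<close> are the group operations; the types \<open>'p\<close> and \<open>'q\<close>
  name the operations in $\Omega_1' = \Omega_1 \setminus \{-\}$ and
  $\Omega_2' = \Omega_2 \setminus \{+\}$. There are no further operations.\<close>

datatype ('p, 'q) gterm =
    TVar nat
  | TZero
  | TNeg "('p, 'q) gterm"
  | TAdd "('p, 'q) gterm" "('p, 'q) gterm"
  | TUn 'p "('p, 'q) gterm"
  | TBin 'q "('p, 'q) gterm" "('p, 'q) gterm"

text \<open>\<open>unops\<close> is $\Omega_1'$, \<open>binops\<close> is $\Omega_2'$ (either may be empty),
  \<open>opp\<close> is $\star \mapsto \star^\circ$ and \<open>idents\<close> is $\mathsf{E}$.\<close>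

record ('p, 'q) gwo_theory =
  unops :: "'p set"
  binops :: "'q set"
  opp :: "'q \<Rightarrow> 'q"
  idents :: "(('p, 'q) gterm \<times> ('p, 'q) gterm) set"

fun wf_gterm :: "('p, 'q) gwo_theory \<Rightarrow> ('p, 'q) gterm \<Rightarrow> bool" where
  "wf_gterm T (TVar n) = True"
| "wf_gterm T TZero = True"
| "wf_gterm T (TNeg t) = wf_gterm T t"
| "wf_gterm T (TAdd t u) = (wf_gterm T t \<and> wf_gterm T u)"
| "wf_gterm T (TUn w t) = (w \<in> unops T \<and> wf_gterm T t)"
| "wf_gterm T (TBin q t u) = (q \<in> binops T \<and> wf_gterm T t \<and> wf_gterm T u)"

definition group_idents :: "(('p, 'q) gterm \<times> ('p, 'q) gterm) set" where
  "group_idents =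
     {(TAdd (TAdd (TVar 0) (TVar 1)) (TVar 2), TAdd (TVar 0) (TAdd (TVar 1) (TVar 2))),
      (TAdd TZero (TVar 0), TVar 0),
      (TAdd (TVar 0) TZero, TVar 0),
      (TAdd (TNeg (TVar 0)) (TVar 0), TZero),
      (TAdd (TVar 0) (TNeg (TVar 0)), TZero)}"

locale groups_with_operations =
  fixes T :: "('p, 'q) gwo_theory"
  assumes idents_wf: "(l, r) \<in> idents T \<Longrightarrow> wf_gterm T l \<and> wf_gterm T r"
    and group_laws: "group_idents \<subseteq> idents T"
    and opp_closed: "q \<in> binops T \<Longrightarrow> opp T q \<in> binops T"
    and opp_law: "q \<in> binops T \<Longrightarrow>
      (TBin (opp T q) (TVar 0) (TVar 1), TBin q (TVar 1) (TVar 0)) \<in> idents T"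
    and distrib_law: "q \<in> binops T \<Longrightarrow>
      (TBin q (TVar 0) (TAdd (TVar 1) (TVar 2)),
       TAdd (TBin q (TVar 0) (TVar 1)) (TBin q (TVar 0) (TVar 2))) \<in> idents T"
    and unop_add_law: "w \<in> unops T \<Longrightarrow>
      (TUn w (TAdd (TVar 0) (TVar 1)), TAdd (TUn w (TVar 0)) (TUn w (TVar 1))) \<in> idents T"
    and unop_bin_law: "w \<in> unops T \<Longrightarrow> q \<in> binops T \<Longrightarrow>
      (TBin q (TUn w (TVar 0)) (TVar 1), TUn w (TBin q (TVar 0) (TVar 1))) \<in> idents T"

record ('a, 'p, 'q) gwo =
  carr :: "'a set"
  gzero :: 'a ("\<zero>\<index>")
  gneg :: "'a \<Rightarrow> 'a" ("\<ominus>\<index> _" [81] 80)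
  gadd :: "'a \<Rightarrow> 'a \<Rightarrow> 'a" (infixl "\<oplus>\<index>" 65)
  unop :: "'p \<Rightarrow> 'a \<Rightarrow> 'a"
  binop :: "'q \<Rightarrow> 'a \<Rightarrow> 'a \<Rightarrow> 'a"

fun gval :: "('a, 'p, 'q) gwo \<Rightarrow> (nat \<Rightarrow> 'a) \<Rightarrow> ('p, 'q) gterm \<Rightarrow> 'a" where
  "gval A v (TVar n) = v n"
| "gval A v TZero = gzero A"
| "gval A v (TNeg t) = gneg A (gval A v t)"
| "gval A v (TAdd t u) = gadd A (gval A v t) (gval A v u)"
| "gval A v (TUn w t) = unop A w (gval A v t)"
| "gval A v (TBin q t u) = binop A q (gval A v t) (gval A v u)"

text \<open>The objects of $\mathsf{C}$ with underlying set in the type \<open>'a\<close>. Values of the operations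
  outside the carrier, or at symbols outside \<open>unops\<close> and \<open>binops\<close>, are irrelevant: objects
  differing only there are isomorphic in $\mathsf{C}$ via the identity map.\<close>

locale gwo_object =
  fixes T :: "('p, 'q) gwo_theory" and A :: "('a, 'p, 'q) gwo"
  assumes zero_closed: "gzero A \<in> carr A"
    and neg_closed: "x \<in> carr A \<Longrightarrow> gneg A x \<in> carr A"
    and add_closed: "x \<in> carr A \<Longrightarrow> y \<in> carr A \<Longrightarrow> gadd A x y \<in> carr A"
    and unop_closed: "w \<in> unops T \<Longrightarrow> x \<in> carr A \<Longrightarrow> unop A w x \<in> carr A"
    and binop_closed: "q \<in> binops T \<Longrightarrow> x \<in> carr A \<Longrightarrow> y \<in> carr A \<Longrightarrow> binop A q x y \<in> carr A"
    and satisfies: "(l, r) \<in> idents T \<Longrightarrow> range v \<subseteq> carr A \<Longrightarrow> gval A v l = gval A v r"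

text \<open>Morphisms are extensional functions, so that HOL equality of functions is equality of
  morphisms.\<close>

definition gwo_hom ::
  "('p, 'q) gwo_theory \<Rightarrow> ('a, 'p, 'q) gwo \<Rightarrow> ('b, 'p, 'q) gwo \<Rightarrow> ('a \<Rightarrow> 'b) set" where
  "gwo_hom T A B = {f \<in> carr A \<rightarrow>\<^sub>E carr B.
     (\<forall>x\<in>carr A. \<forall>y\<in>carr A. f (x \<oplus>\<^bsub>A\<^esub> y) = f x \<oplus>\<^bsub>B\<^esub> f y) \<and>
     (\<forall>w\<in>unops T. \<forall>x\<in>carr A. f (unop A w x) = unop B w (f x)) \<and>
     (\<forall>q\<in>binops T. \<forall>x\<in>carr A. \<forall>y\<in>carr A. f (binop A q x y) = binop B q (f x) (f y))}"

definition gwo_iso ::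
  "('p, 'q) gwo_theory \<Rightarrow> ('a, 'p, 'q) gwo \<Rightarrow> ('b, 'p, 'q) gwo \<Rightarrow> ('a \<Rightarrow> 'b) set" where
  "gwo_iso T A B = {f \<in> gwo_hom T A B. \<exists>g\<in>gwo_hom T B A.
     (\<forall>x\<in>carr A. g (f x) = x) \<and> (\<forall>y\<in>carr B. f (g y) = y)}"

definition gwo_ker :: "('a, 'p, 'q) gwo \<Rightarrow> ('b, 'p, 'q) gwo \<Rightarrow> ('a \<Rightarrow> 'b) \<Rightarrow> 'a set" where
  "gwo_ker A B f = {x \<in> carr A. f x = \<zero>\<^bsub>B\<^esub>}"

definition ker_object ::
  "('a, 'p, 'q) gwo \<Rightarrow> ('b, 'p, 'q) gwo \<Rightarrow> ('a \<Rightarrow> 'b) \<Rightarrow> ('a, 'p, 'q) gwo" where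
  "ker_object A B f = A\<lparr>carr := gwo_ker A B f\<rparr>"

section \<open>Derived actions and semidirect products\<close>

text \<open>\<open>dot b a\<close> is $b\cdot a$ and \<open>star q b a\<close> is $b \star a$ for the operation \<open>q\<close>. The middle term
  \<open>E\<close> of the split extension may be taken with underlying set in \<open>'a \<times> 'a\<close> without loss of
  generality, since it is in bijection with \<open>carr A \<times> carr B\<close>.\<close>

definition derived_actions ::
  "('p, 'q) gwo_theory \<Rightarrow> ('a, 'p, 'q) gwo \<Rightarrow> ('a, 'p, 'q) gwo \<Rightarrow>
   ('a \<Rightarrow> 'a \<Rightarrow> 'a) \<Rightarrow> ('q \<Rightarrow> 'a \<Rightarrow> 'a \<Rightarrow> 'a) \<Rightarrow> bool" where
  "derived_actions T A B dot star \<longleftrightarrow>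
     (\<forall>b\<in>carr B. \<forall>a\<in>carr A. dot b a \<in> carr A) \<and>
     (\<forall>q\<in>binops T. \<forall>b\<in>carr B. \<forall>a\<in>carr A. star q b a \<in> carr A) \<and>
     (\<exists>(E :: ('a \<times> 'a, 'p, 'q) gwo) i p s.
        gwo_object T E \<and>
        i \<in> gwo_hom T A E \<and> inj_on i (carr A) \<and> i ` carr A = gwo_ker E B p \<and>
        p \<in> gwo_hom T E B \<and> p ` carr E = carr B \<and>
        s \<in> gwo_hom T B E \<and> (\<forall>b\<in>carr B. p (s b) = b) \<and>
        (\<forall>b\<in>carr B. \<forall>a\<in>carr A. i (dot b a) = s b \<oplus>\<^bsub>E\<^esub> i a \<oplus>\<^bsub>E\<^esub> (\<ominus>\<^bsub>E\<^esub> s b)) \<and>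
        (\<forall>q\<in>binops T. \<forall>b\<in>carr B. \<forall>a\<in>carr A. i (star q b a) = binop E q (s b) (i a)))"

text \<open>In the middle summand of \<open>binop\<close> below, $a' \star b = b \star^\circ a'$. The negative of
  $(a,b)$ is $((-b)\cdot(-a), -b)$.\<close>

definition semidirect ::
  "('p, 'q) gwo_theory \<Rightarrow> ('a, 'p, 'q) gwo \<Rightarrow> ('a, 'p, 'q) gwo \<Rightarrow>
   ('a \<Rightarrow> 'a \<Rightarrow> 'a) \<Rightarrow> ('q \<Rightarrow> 'a \<Rightarrow> 'a \<Rightarrow> 'a) \<Rightarrow> ('a \<times> 'a, 'p, 'q) gwo" where
  "semidirect T A B dot star =
     \<lparr>carr = carr A \<times> carr B,
      gzero = (\<zero>\<^bsub>A\<^esub>, \<zero>\<^bsub>B\<^esub>),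
      gneg = (\<lambda>(a, b). (dot (\<ominus>\<^bsub>B\<^esub> b) (\<ominus>\<^bsub>A\<^esub> a), \<ominus>\<^bsub>B\<^esub> b)),
      gadd = (\<lambda>(a', b') (a, b). (a' \<oplus>\<^bsub>A\<^esub> dot b' a, b' \<oplus>\<^bsub>B\<^esub> b)),
      unop = (\<lambda>w (a, b). (unop A w a, unop B w b)),
      binop = (\<lambda>q (a', b') (a, b).
        (binop A q a' a \<oplus>\<^bsub>A\<^esub> star (opp T q) b a' \<oplus>\<^bsub>A\<^esub> star q b' a, binop B q b' b))\<rparr>"

section \<open>Crossed modules\<close>

record ('a, 'p, 'q) xmod =
  xdom :: "('a, 'p, 'q) gwo"
  xcod :: "('a, 'p, 'q) gwo"
  xdot :: "'a \<Rightarrow> 'a \<Rightarrow> 'a"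
  xstar :: "'q \<Rightarrow> 'a \<Rightarrow> 'a \<Rightarrow> 'a"
  xmap :: "'a \<Rightarrow> 'a"

locale crossed_module =
  fixes T :: "('p, 'q) gwo_theory" and X :: "('a, 'p, 'q) xmod"
    and A and B and \<alpha>
  defines "A \<equiv> xdom X" and "B \<equiv> xcod X" and "\<alpha> \<equiv> xmap X"
  assumes dom_object: "gwo_object T A"
    and cod_object: "gwo_object T B"
    and actions: "derived_actions T A B (xdot X) (xstar X)"
    and map_hom: "\<alpha> \<in> gwo_hom T A B"
    and map_dot: "b \<in> carr B \<Longrightarrow> a \<in> carr A \<Longrightarrow>
      \<alpha> (xdot X b a) = b \<oplus>\<^bsub>B\<^esub> \<alpha> a \<oplus>\<^bsub>B\<^esub> (\<ominus>\<^bsub>B\<^esub> b)"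
    and peiffer_dot: "a \<in> carr A \<Longrightarrow> a' \<in> carr A \<Longrightarrow>
      xdot X (\<alpha> a) a' = a \<oplus>\<^bsub>A\<^esub> a' \<oplus>\<^bsub>A\<^esub> (\<ominus>\<^bsub>A\<^esub> a)"
    and peiffer_star: "q \<in> binops T \<Longrightarrow> a \<in> carr A \<Longrightarrow> a' \<in> carr A \<Longrightarrow>
      xstar X q (\<alpha> a) a' = binop A q a a'"
    and map_star_left: "q \<in> binops T \<Longrightarrow> b \<in> carr B \<Longrightarrow> a \<in> carr A \<Longrightarrow>
      \<alpha> (xstar X q b a) = binop B q b (\<alpha> a)"
    and map_star_right: "q \<in> binops T \<Longrightarrow> b \<in> carr B \<Longrightarrow> a \<in> carr A \<Longrightarrow>
      \<alpha> (xstar X (opp T q) b a) = binop B q (\<alpha> a) b"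

definition xmod_hom ::
  "('p, 'q) gwo_theory \<Rightarrow> ('a, 'p, 'q) xmod \<Rightarrow> ('a, 'p, 'q) xmod \<Rightarrow> (('a \<Rightarrow> 'a) \<times> ('a \<Rightarrow> 'a)) set" where
  "xmod_hom T X Y = {(f, g).
     f \<in> gwo_hom T (xdom X) (xdom Y) \<and> g \<in> gwo_hom T (xcod X) (xcod Y) \<and>
     (\<forall>a\<in>carr (xdom X). g (xmap X a) = xmap Y (f a)) \<and>
     (\<forall>b\<in>carr (xcod X). \<forall>a\<in>carr (xdom X). f (xdot X b a) = xdot Y (g b) (f a)) \<and>
     (\<forall>q\<in>binops T. \<forall>b\<in>carr (xcod X). \<forall>a\<in>carr (xdom X).
        f (xstar X q b a) = xstar Y q (g b) (f a))}"

definition xmod_covering ::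
  "('p, 'q) gwo_theory \<Rightarrow> ('a, 'p, 'q) xmod \<Rightarrow> ('a, 'p, 'q) xmod \<Rightarrow> ('a \<Rightarrow> 'a) \<times> ('a \<Rightarrow> 'a) \<Rightarrow> bool" where
  "xmod_covering T Y X h \<longleftrightarrow> h \<in> xmod_hom T Y X \<and> fst h \<in> gwo_iso T (xdom Y) (xdom X)"

section \<open>Cat$^1$-groups with operations\<close>

record ('a, 'p, 'q) cat1 =
  cgrp :: "('a, 'p, 'q) gwo"
  csrc :: "'a \<Rightarrow> 'a"
  ctgt :: "'a \<Rightarrow> 'a"

abbreviation ker_src :: "('a, 'p, 'q) cat1 \<Rightarrow> 'a set" where
  "ker_src C \<equiv> gwo_ker (cgrp C) (cgrp C) (csrc C)"

abbreviation ker_tgt :: "('a, 'p, 'q) cat1 \<Rightarrow> 'a set" where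
  "ker_tgt C \<equiv> gwo_ker (cgrp C) (cgrp C) (ctgt C)"

locale cat1_group =
  fixes T :: "('p, 'q) gwo_theory" and C :: "('a, 'p, 'q) cat1"
    and G and s and t
  defines "G \<equiv> cgrp C" and "s \<equiv> csrc C" and "t \<equiv> ctgt C"
  assumes object: "gwo_object T G"
    and src_hom: "s \<in> gwo_hom T G G"
    and tgt_hom: "t \<in> gwo_hom T G G"
    and src_tgt: "x \<in> carr G \<Longrightarrow> s (t x) = t x"
    and tgt_src: "x \<in> carr G \<Longrightarrow> t (s x) = s x"
    and ker_commute: "x \<in> ker_src C \<Longrightarrow> y \<in> ker_tgt C \<Longrightarrow> x \<oplus>\<^bsub>G\<^esub> y = y \<oplus>\<^bsub>G\<^esub> x"
    and ker_star: "q \<in> binops T \<Longrightarrow> x \<in> ker_src C \<Longrightarrow> y \<in> ker_tgt C \<Longrightarrow> binop G q x y = \<zero>\<^bsub>G\<^esub>"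

definition cat1_hom ::
  "('p, 'q) gwo_theory \<Rightarrow> ('a, 'p, 'q) cat1 \<Rightarrow> ('a, 'p, 'q) cat1 \<Rightarrow> ('a \<Rightarrow> 'a) set" where
  "cat1_hom T C D = {f \<in> gwo_hom T (cgrp C) (cgrp D).
     (\<forall>x\<in>carr (cgrp C). f (csrc C x) = csrc D (f x)) \<and>
     (\<forall>x\<in>carr (cgrp C). f (ctgt C x) = ctgt D (f x))}"

definition cat1_covering ::
  "('p, 'q) gwo_theory \<Rightarrow> ('a, 'p, 'q) cat1 \<Rightarrow> ('a, 'p, 'q) cat1 \<Rightarrow> ('a \<Rightarrow> 'a) \<Rightarrow> bool" where
  "cat1_covering T D C p \<longleftrightarrow> p \<in> cat1_hom T D C \<and>
     restrict p (ker_src D) \<in>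
       gwo_iso T (ker_object (cgrp D) (cgrp D) (csrc D)) (ker_object (cgrp C) (cgrp C) (csrc C))"

definition xmod_cat1 ::
  "('p, 'q) gwo_theory \<Rightarrow> ('a, 'p, 'q) xmod \<Rightarrow> ('a \<times> 'a, 'p, 'q) cat1" where
  "xmod_cat1 T X =
     (let A = xdom X; B = xcod X; G = semidirect T A B (xdot X) (xstar X) in
      \<lparr>cgrp = G,
       csrc = restrict (\<lambda>(a, b). (\<zero>\<^bsub>A\<^esub>, b)) (carr G),
       ctgt = restrict (\<lambda>(a, b). (\<zero>\<^bsub>A\<^esub>, xmap X a \<oplus>\<^bsub>B\<^esub> b)) (carr G)\<rparr>)"

section \<open>Categories and their equivalence\<close>

text \<open>Arrows do not carry their domain and codomain, so identities, composition and the arrow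
  part of a functor take the objects involved as arguments: \<open>Comp C x y z g f\<close> is $g \circ f$ for
  $f : x \to y$ and $g : y \to z$.\<close>

record ('o, 'm) cat =
  Ob :: "'o set"
  Hom :: "'o \<Rightarrow> 'o \<Rightarrow> 'm set"
  Ident :: "'o \<Rightarrow> 'm"
  Comp :: "'o \<Rightarrow> 'o \<Rightarrow> 'o \<Rightarrow> 'm \<Rightarrow> 'm \<Rightarrow> 'm"

locale is_category =
  fixes C :: "('o, 'm) cat"
  assumes ident_hom: "x \<in> Ob C \<Longrightarrow> Ident C x \<in> Hom C x x"
    and comp_hom: "x \<in> Ob C \<Longrightarrow> y \<in> Ob C \<Longrightarrow> z \<in> Ob C \<Longrightarrow>
      f \<in> Hom C x y \<Longrightarrow> g \<in> Hom C y z \<Longrightarrow> Comp C x y z g f \<in> Hom C x z"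
    and comp_ident: "x \<in> Ob C \<Longrightarrow> y \<in> Ob C \<Longrightarrow> f \<in> Hom C x y \<Longrightarrow> Comp C x x y f (Ident C x) = f"
    and ident_comp: "x \<in> Ob C \<Longrightarrow> y \<in> Ob C \<Longrightarrow> f \<in> Hom C x y \<Longrightarrow> Comp C x y y (Ident C y) f = f"
    and comp_assoc: "w \<in> Ob C \<Longrightarrow> x \<in> Ob C \<Longrightarrow> y \<in> Ob C \<Longrightarrow> z \<in> Ob C \<Longrightarrow>
      f \<in> Hom C w x \<Longrightarrow> g \<in> Hom C x y \<Longrightarrow> h \<in> Hom C y z \<Longrightarrow>
      Comp C w x z (Comp C x y z h g) f = Comp C w y z h (Comp C w x y g f)"

record ('o, 'm, 'o2, 'm2) cfunctor =
  fob :: "'o \<Rightarrow> 'o2"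
  farr :: "'o \<Rightarrow> 'o \<Rightarrow> 'm \<Rightarrow> 'm2"

locale is_functor =
  fixes C :: "('o, 'm) cat" and D :: "('o2, 'm2) cat" and F :: "('o, 'm, 'o2, 'm2) cfunctor"
  assumes fob_closed: "x \<in> Ob C \<Longrightarrow> fob F x \<in> Ob D"
    and farr_hom: "x \<in> Ob C \<Longrightarrow> y \<in> Ob C \<Longrightarrow> f \<in> Hom C x y \<Longrightarrow>
      farr F x y f \<in> Hom D (fob F x) (fob F y)"
    and farr_ident: "x \<in> Ob C \<Longrightarrow> farr F x x (Ident C x) = Ident D (fob F x)"
    and farr_comp: "x \<in> Ob C \<Longrightarrow> y \<in> Ob C \<Longrightarrow> z \<in> Ob C \<Longrightarrow> f \<in> Hom C x y \<Longrightarrow> g \<in> Hom C y z \<Longrightarrow>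
      farr F x z (Comp C x y z g f) =
      Comp D (fob F x) (fob F y) (fob F z) (farr F y z g) (farr F x y f)"

definition functor_id :: "('o, 'm, 'o, 'm) cfunctor" where
  "functor_id = \<lparr>fob = (\<lambda>x. x), farr = (\<lambda>x y f. f)\<rparr>"

definition functor_comp ::
  "('o2, 'm2, 'o3, 'm3) cfunctor \<Rightarrow> ('o, 'm, 'o2, 'm2) cfunctor \<Rightarrow> ('o, 'm, 'o3, 'm3) cfunctor" where
  "functor_comp G F = \<lparr>fob = (\<lambda>x. fob G (fob F x)),
     farr = (\<lambda>x y f. farr G (fob F x) (fob F y) (farr F x y f))\<rparr>"

definition cat_iso :: "('o, 'm) cat \<Rightarrow> 'o \<Rightarrow> 'o \<Rightarrow> 'm set" where
  "cat_iso C x y = {f \<in> Hom C x y. \<exists>g\<in>Hom C y x.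
     Comp C x y x g f = Ident C x \<and> Comp C y x y f g = Ident C y}"

definition naturally_isomorphic ::
  "('o, 'm) cat \<Rightarrow> ('o2, 'm2) cat \<Rightarrow> ('o, 'm, 'o2, 'm2) cfunctor \<Rightarrow> ('o, 'm, 'o2, 'm2) cfunctor \<Rightarrow> bool" where
  "naturally_isomorphic C D F G \<longleftrightarrow> (\<exists>\<eta>.
     (\<forall>x\<in>Ob C. \<eta> x \<in> cat_iso D (fob F x) (fob G x)) \<and>
     (\<forall>x\<in>Ob C. \<forall>y\<in>Ob C. \<forall>f\<in>Hom C x y.
        Comp D (fob F x) (fob F y) (fob G y) (\<eta> y) (farr F x y f) =
        Comp D (fob F x) (fob G x) (fob G y) (farr G x y f) (\<eta> x)))"

definition equivalent_categories :: "('o, 'm) cat \<Rightarrow> ('o2, 'm2) cat \<Rightarrow> bool" where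
  "equivalent_categories C D \<longleftrightarrow> is_category C \<and> is_category D \<and>
     (\<exists>F G. is_functor C D F \<and> is_functor D C G \<and>
        naturally_isomorphic C C (functor_comp G F) functor_id \<and>
        naturally_isomorphic D D (functor_comp F G) functor_id)"

section \<open>The categories of coverings\<close>

text \<open>A type \<open>'a\<close> plays the role of a universe: the categories below consist of all structures with
  underlying sets in \<open>'a\<close>. The cat$^1$-group of a crossed module over \<open>'a\<close> has its underlying
  set in \<open>'a \<times> 'a\<close>; for infinite \<open>'a\<close> the two universes are equipotent. For finite \<open>'a\<close> the
  type \<open>'a \<times> 'a\<close> may admit coverings too large for \<open>'a\<close>, so an infinite universe is required
  when the categories over both types are compared.\<close>

definition xmod_cat :: "('p, 'q) gwo_theory \<Rightarrow> (('a, 'p, 'q) xmod, ('a \<Rightarrow> 'a) \<times> ('a \<Rightarrow> 'a)) cat" where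
  "xmod_cat T =
     \<lparr>Ob = {X. crossed_module T X},
      Hom = xmod_hom T,
      Ident = (\<lambda>X. (restrict (\<lambda>a. a) (carr (xdom X)), restrict (\<lambda>b. b) (carr (xcod X)))),
      Comp = (\<lambda>X Y Z (f', g') (f, g). (compose (carr (xdom X)) f' f, compose (carr (xcod X)) g' g))\<rparr>"

definition cat1_cat :: "('p, 'q) gwo_theory \<Rightarrow> (('a, 'p, 'q) cat1, 'a \<Rightarrow> 'a) cat" where
  "cat1_cat T =
     \<lparr>Ob = {C. cat1_group T C},
      Hom = cat1_hom T,
      Ident = (\<lambda>C. restrict (\<lambda>x. x) (carr (cgrp C))),
      Comp = (\<lambda>C D E f' f. compose (carr (cgrp C)) f' f)\<rparr>"

text \<open>The category of covering morphisms over \<open>X\<close>, where \<open>cov Y X p\<close> says that \<open>p : Y \<rightarrow> X\<close> is a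
  covering morphism.\<close>

definition covering_cat ::
  "('o, 'm) cat \<Rightarrow> ('o \<Rightarrow> 'o \<Rightarrow> 'm \<Rightarrow> bool) \<Rightarrow> 'o \<Rightarrow> ('o \<times> 'm, 'm) cat" where
  "covering_cat C cov X =
     \<lparr>Ob = {(Y, p). Y \<in> Ob C \<and> p \<in> Hom C Y X \<and> cov Y X p},
      Hom = (\<lambda>(Y, p) (Z, q). {h \<in> Hom C Y Z. Comp C Y Z X q h = p}),
      Ident = (\<lambda>(Y, p). Ident C Y),
      Comp = (\<lambda>(Y, p) (Z, q) (W, r). Comp C Y Z W)\<rparr>"

definition xmod_covering_cat ::
  "('p, 'q) gwo_theory \<Rightarrow> ('a, 'p, 'q) xmod \<Rightarrow>
   (('a, 'p, 'q) xmod \<times> ('a \<Rightarrow> 'a) \<times> ('a \<Rightarrow> 'a), ('a \<Rightarrow> 'a) \<times> ('a \<Rightarrow> 'a)) cat" where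
  "xmod_covering_cat T X = covering_cat (xmod_cat T) (xmod_covering T) X"

definition cat1_covering_cat ::
  "('p, 'q) gwo_theory \<Rightarrow> ('a, 'p, 'q) cat1 \<Rightarrow> (('a, 'p, 'q) cat1 \<times> ('a \<Rightarrow> 'a), 'a \<Rightarrow> 'a) cat" where
  "cat1_covering_cat T C = covering_cat (cat1_cat T) (cat1_covering T) C"

end

theory Submission
  imports Defs
begin

text \<open>
  Passing from a crossed module to its cat$^1$-group is a functor $F$ from all crossed modules to
  all cat$^1$-groups, and $F$ is already an equivalence before coverings are mentioned:

  \<^item> It is fully faithful. Since $A \times 0 = \ker s$ and $0 \times B = \operatorname{im} s$ in
    $A \rtimes B$, a morphism $k$ that respects $s$ preserves both factors, and
    $(a,b) = (a,0) + (0,b)$ forces $k = f \times g$. Each condition on $(f,g)$ is what $k$ says about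
    one particular sum, product or value of $t$ (\<open>semidirect_map_surj\<close>).

  \<^item> It is essentially surjective. A cat$^1$-group $(G,s,t)$ is a split extension of
    $\operatorname{im} s$ by $\ker s$, so $(a,b) \mapsto a + b$ is an isomorphism
    $\ker s \rtimes \operatorname{im} s \cong G$ (\<open>split_sum_iso\<close>), and the restriction
    $\ker s \to \operatorname{im} s$ of $t$ is a crossed module. For the Peiffer identities write
    $t(a) = a + d$; then $d = -a + t(a)$ lies in $\ker t$, so by the two kernel conditions it
    commutes with every $a' \in \ker s$ and satisfies $d \star a' = 0$
    (\<open>conj_by_tgt\<close>, \<open>star_by_tgt\<close>).

  The morphism $f \times g$ restricts to $f$ on $\ker s = A \times 0$, so a morphism of crossed modules is a
  covering exactly when its image under $F$ is (\<open>semidirect_map_covering_iff\<close>). An equivalence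
  with this property restricts to the coverings over any object, provided that coverings remain
  coverings after precomposition with an isomorphism (\<open>covering_cat_equivalence\<close>).

  A cat$^1$-group obtained from a crossed module on \<open>'a\<close> lives on \<open>'a \<times> 'a\<close>. To read a crossed
  module over \<open>'a\<close> off an arbitrary cat$^1$-group on \<open>'a \<times> 'a\<close>, kernel and image are moved along an
  injection \<open>'a \<times> 'a \<Rightarrow> 'a\<close>; this is where the infinite universe enters.
\<close>

section \<open>Equivalences of categories\<close>

definition fully_faithful :: "('o, 'm) cat \<Rightarrow> ('o2, 'm2) cat \<Rightarrow> ('o, 'm, 'o2, 'm2) cfunctor \<Rightarrow> bool" where
  "fully_faithful C D F \<longleftrightarrow>
     (\<forall>x\<in>Ob C. \<forall>y\<in>Ob C. bij_betw (farr F x y) (Hom C x y) (Hom D (fob F x) (fob F y)))"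

definition essentially_surjective ::
  "('o, 'm) cat \<Rightarrow> ('o2, 'm2) cat \<Rightarrow> ('o, 'm, 'o2, 'm2) cfunctor \<Rightarrow> bool" where
  "essentially_surjective C D F \<longleftrightarrow> (\<forall>d\<in>Ob D. \<exists>x\<in>Ob C. cat_iso D (fob F x) d \<noteq> {})"

text \<open>Choose for every $d$ an isomorphism $e_d : F(g\,d) \to d$. Then \<open>adj\<close>, $u \mapsto e_d \circ F u$, is a
  bijection $\mathrm{Hom}(x, g\,d) \to \mathrm{Hom}(F x, d)$, and the quasi-inverse sends $h : d \to d'$ to the
  unique $u$ with $e_{d'} \circ F u = h \circ e_d$. Its functor laws are comparisons after applying
  the injective map \<open>adj\<close>, the counit $e$ is natural by the choice of $u$, and the unit is obtained
  by lifting $e_{F x}$ along $F$.\<close>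

theorem fully_faithful_essentially_surjective_equivalence:
  fixes C :: "('o, 'm) cat" and D :: "('o2, 'm2) cat"
  assumes catC: "is_category C" and catD: "is_category D" and functorF: "is_functor C D F"
    and ff: "fully_faithful C D F" and es: "essentially_surjective C D F"
  shows "equivalent_categories C D"
proof -
  interpret C: is_category C by fact
  interpret D: is_category D by fact
  interpret F: is_functor C D F by fact
  have "\<forall>d\<in>Ob D. \<exists>x e. x \<in> Ob C \<and> e \<in> cat_iso D (fob F x) d"
    using es unfolding essentially_surjective_def by blast
  then obtain g e where g: "d \<in> Ob D \<Longrightarrow> g d \<in> Ob C"
    and e_iso: "d \<in> Ob D \<Longrightarrow> e d \<in> cat_iso D (fob F (g d)) d" for d
    by metis
  have Fg: "fob F (g d) \<in> Ob D" if "d \<in> Ob D" for d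
    using that by (intro F.fob_closed g)
  have e: "e d \<in> Hom D (fob F (g d)) d" if "d \<in> Ob D" for d
    using e_iso[OF that] by (simp add: cat_iso_def)
  have "\<forall>d\<in>Ob D. \<exists>e'. e' \<in> Hom D d (fob F (g d)) \<and>
      Comp D (fob F (g d)) d (fob F (g d)) e' (e d) = Ident D (fob F (g d)) \<and>
      Comp D d (fob F (g d)) d (e d) e' = Ident D d"
    using e_iso by (auto simp: cat_iso_def)
  then obtain e' where e': "d \<in> Ob D \<Longrightarrow> e' d \<in> Hom D d (fob F (g d))"
    and e'e: "d \<in> Ob D \<Longrightarrow> Comp D (fob F (g d)) d (fob F (g d)) (e' d) (e d) = Ident D (fob F (g d))"
    and ee': "d \<in> Ob D \<Longrightarrow> Comp D d (fob F (g d)) d (e d) (e' d) = Ident D d" for d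
    by metis
  have full: "\<exists>u\<in>Hom C x y. farr F x y u = h"
    if "x \<in> Ob C" "y \<in> Ob C" "h \<in> Hom D (fob F x) (fob F y)" for x y h
  proof -
    have "farr F x y ` Hom C x y = Hom D (fob F x) (fob F y)"
      using ff that unfolding fully_faithful_def bij_betw_def by blast
    then show ?thesis using that(3) by (metis imageE)
  qed
  have faithful: "u = v"
    if "x \<in> Ob C" "y \<in> Ob C" "u \<in> Hom C x y" "v \<in> Hom C x y" "farr F x y u = farr F x y v" for x y u v
    using ff that unfolding fully_faithful_def bij_betw_def by (meson inj_onD)
  define adj where "adj x d u = Comp D (fob F x) (fob F (g d)) d (e d) (farr F x (g d) u)" for x d u
  have adj_hom: "adj x d u \<in> Hom D (fob F x) d" if "x \<in> Ob C" "d \<in> Ob D" "u \<in> Hom C x (g d)" for x d u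
    unfolding adj_def using that by (intro D.comp_hom F.fob_closed F.farr_hom e g)
  have adj_surj: "\<exists>u\<in>Hom C x (g d). adj x d u = h"
    if x: "x \<in> Ob C" and d: "d \<in> Ob D" and h: "h \<in> Hom D (fob F x) d" for x d h
  proof -
    have "Comp D (fob F x) d (fob F (g d)) (e' d) h \<in> Hom D (fob F x) (fob F (g d))"
      using x d h by (intro D.comp_hom F.fob_closed e' g)
    then obtain u where u: "u \<in> Hom C x (g d)"
      and Fu: "farr F x (g d) u = Comp D (fob F x) d (fob F (g d)) (e' d) h"
      using full[OF x g[OF d]] by blast
    have "adj x d u = Comp D (fob F x) d d (Comp D d (fob F (g d)) d (e d) (e' d)) h"
      unfolding adj_def Fu
      by (rule D.comp_assoc[symmetric]) (use x d h e e' Fg F.fob_closed in auto)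
    also have "\<dots> = h"
      using ee'[OF d] D.ident_comp[OF F.fob_closed[OF x] d h] by simp
    finally show ?thesis using u by blast
  qed
  have adj_inj: "u = v"
    if x: "x \<in> Ob C" and d: "d \<in> Ob D" and u: "u \<in> Hom C x (g d)" and v: "v \<in> Hom C x (g d)"
      and eq: "adj x d u = adj x d v" for x d u v
  proof -
    have "Comp D (fob F x) d (fob F (g d)) (e' d) (adj x d w) = farr F x (g d) w"
      if w: "w \<in> Hom C x (g d)" for w
    proof -
      have Fw: "farr F x (g d) w \<in> Hom D (fob F x) (fob F (g d))"
        using x d w by (intro F.farr_hom g)
      have "Comp D (fob F x) d (fob F (g d)) (e' d) (adj x d w) =
        Comp D (fob F x) (fob F (g d)) (fob F (g d))
          (Comp D (fob F (g d)) d (fob F (g d)) (e' d) (e d)) (farr F x (g d) w)"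
        unfolding adj_def
        by (rule D.comp_assoc[symmetric]) (use x d Fw e e' Fg F.fob_closed in auto)
      also have "\<dots> = farr F x (g d) w"
        using e'e[OF d] D.ident_comp[OF F.fob_closed[OF x] Fg[OF d] Fw] by simp
      finally show ?thesis .
    qed
    from this[OF u] this[OF v] eq have "farr F x (g d) u = farr F x (g d) v" by simp
    then show ?thesis by (rule faithful[OF x g[OF d] u v])
  qed
  have adj_comp: "adj w d (Comp C w x (g d) u v) = Comp D (fob F w) (fob F x) d (adj x d u) (farr F w x v)"
    if "w \<in> Ob C" "x \<in> Ob C" "d \<in> Ob D" "v \<in> Hom C w x" "u \<in> Hom C x (g d)" for w x d u v
  proof -
    have "farr F w (g d) (Comp C w x (g d) u v) =
      Comp D (fob F w) (fob F x) (fob F (g d)) (farr F x (g d) u) (farr F w x v)"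
      using that by (intro F.farr_comp g)
    then show ?thesis
      unfolding adj_def using that
      by (simp add: D.comp_assoc[OF F.fob_closed F.fob_closed Fg _ F.farr_hom F.farr_hom e] g)
  qed
  have "\<forall>d\<in>Ob D. \<forall>d'\<in>Ob D. \<forall>h\<in>Hom D d d'. \<exists>u. u \<in> Hom C (g d) (g d') \<and>
      adj (g d) d' u = Comp D (fob F (g d)) d d' h (e d)"
  proof (intro ballI)
    fix d d' h assume "d \<in> Ob D" "d' \<in> Ob D" "h \<in> Hom D d d'"
    then show "\<exists>u. u \<in> Hom C (g d) (g d') \<and> adj (g d) d' u = Comp D (fob F (g d)) d d' h (e d)"
      using adj_surj[of "g d" d' "Comp D (fob F (g d)) d d' h (e d)"] D.comp_hom[OF Fg _ _ e] g by blast
  qed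
  then obtain r where r_hom: "d \<in> Ob D \<Longrightarrow> d' \<in> Ob D \<Longrightarrow> h \<in> Hom D d d' \<Longrightarrow> r d d' h \<in> Hom C (g d) (g d')"
    and adj_r: "d \<in> Ob D \<Longrightarrow> d' \<in> Ob D \<Longrightarrow> h \<in> Hom D d d' \<Longrightarrow>
      adj (g d) d' (r d d' h) = Comp D (fob F (g d)) d d' h (e d)" for d d' h
    by metis
  define G where "G = \<lparr>fob = g, farr = r\<rparr>"
  have adj_ident: "adj (g d) d (Ident C (g d)) = e d" if "d \<in> Ob D" for d
    unfolding adj_def using that F.farr_ident[OF g[OF that]] D.comp_ident[OF Fg[OF that] that e[OF that]] by simp
  have functorG: "is_functor D C G"
  proof
    fix d assume d: "d \<in> Ob D"
    then show "fob G d \<in> Ob C" by (simp add: G_def g)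
    show "farr G d d (Ident D d) = Ident C (fob G d)"
      unfolding G_def cfunctor.simps
      by (rule adj_inj[of "g d" d])
         (use d g r_hom D.ident_hom C.ident_hom adj_r adj_ident D.ident_comp[OF Fg _ e] in auto)
  next
    fix d d' h assume "d \<in> Ob D" "d' \<in> Ob D" "h \<in> Hom D d d'"
    then show "farr G d d' h \<in> Hom C (fob G d) (fob G d')" by (simp add: G_def r_hom)
  next
    fix x y z f h assume x: "x \<in> Ob D" and y: "y \<in> Ob D" and z: "z \<in> Ob D"
      and f: "f \<in> Hom D x y" and h: "h \<in> Hom D y z"
    have hf: "Comp D x y z h f \<in> Hom D x z" by (rule D.comp_hom[OF x y z f h])
    have "adj (g x) z (Comp C (g x) (g y) (g z) (r y z h) (r x y f)) =
        Comp D (fob F (g x)) (fob F (g y)) z (adj (g y) z (r y z h)) (farr F (g x) (g y) (r x y f))"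
      by (rule adj_comp) (use x y z f h r_hom g in auto)
    also have "\<dots> = Comp D (fob F (g x)) (fob F (g y)) z (Comp D (fob F (g y)) y z h (e y)) (farr F (g x) (g y) (r x y f))"
      using adj_r[OF y z h] by simp
    also have "\<dots> = Comp D (fob F (g x)) y z h (adj (g x) y (r x y f))"
      unfolding adj_def by (rule D.comp_assoc) (use x y z f h r_hom g e Fg F.farr_hom in auto)
    also have "\<dots> = Comp D (fob F (g x)) y z h (Comp D (fob F (g x)) x y f (e x))"
      using adj_r[OF x y f] by simp
    also have "\<dots> = Comp D (fob F (g x)) x z (Comp D x y z h f) (e x)"
      by (rule D.comp_assoc[symmetric]) (use x y z f h e Fg in auto)
    also have "\<dots> = adj (g x) z (r x z (Comp D x y z h f))"
      using adj_r[OF x z hf] by simp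
    finally have "Comp C (g x) (g y) (g z) (r y z h) (r x y f) = r x z (Comp D x y z h f)"
      by (rule adj_inj[rotated -1]) (use x y z f h hf r_hom g C.comp_hom[OF g g g] in auto)
    then show "farr G x z (Comp D x y z h f) =
        Comp C (fob G x) (fob G y) (fob G z) (farr G y z h) (farr G x y f)"
      by (simp add: G_def)
  qed
  have FG: "naturally_isomorphic D D (functor_comp F G) functor_id"
    unfolding naturally_isomorphic_def
    by (intro exI[of _ e]) (use e_iso adj_r in \<open>auto simp: functor_comp_def functor_id_def G_def adj_def\<close>)
  have "\<forall>x\<in>Ob C. \<exists>u. u \<in> Hom C (g (fob F x)) x \<and> farr F (g (fob F x)) x u = e (fob F x)"
    using full g e F.fob_closed by blast
  then obtain \<theta> where \<theta>: "x \<in> Ob C \<Longrightarrow> \<theta> x \<in> Hom C (g (fob F x)) x"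
    and F\<theta>: "x \<in> Ob C \<Longrightarrow> farr F (g (fob F x)) x (\<theta> x) = e (fob F x)" for x
    by metis
  have GF: "naturally_isomorphic C C (functor_comp G F) functor_id"
    unfolding naturally_isomorphic_def
  proof (intro exI[of _ \<theta>] conjI ballI)
    fix x assume x: "x \<in> Ob C"
    have Fx: "fob F x \<in> Ob D" and gFx: "g (fob F x) \<in> Ob C" using x F.fob_closed g by auto
    obtain v where v: "v \<in> Hom C x (g (fob F x))" and Fv: "farr F x (g (fob F x)) v = e' (fob F x)"
      using full[OF x gFx e'[OF Fx]] by blast
    have "Comp C (g (fob F x)) x (g (fob F x)) v (\<theta> x) = Ident C (g (fob F x))"
      by (rule faithful[OF gFx gFx C.comp_hom[OF gFx x gFx \<theta>[OF x] v] C.ident_hom[OF gFx]])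
         (simp add: F.farr_comp[OF gFx x gFx \<theta>[OF x] v] F\<theta>[OF x] Fv e'e[OF Fx] F.farr_ident[OF gFx])
    moreover have "Comp C x (g (fob F x)) x (\<theta> x) v = Ident C x"
      by (rule faithful[OF x x C.comp_hom[OF x gFx x v \<theta>[OF x]] C.ident_hom[OF x]])
         (simp add: F.farr_comp[OF x gFx x v \<theta>[OF x]] F\<theta>[OF x] Fv ee'[OF Fx] F.farr_ident[OF x])
    ultimately show "\<theta> x \<in> cat_iso C (fob (functor_comp G F) x) (fob functor_id x)"
      using \<theta>[OF x] v by (auto simp: cat_iso_def functor_comp_def functor_id_def G_def)
  next
    fix x y f assume x: "x \<in> Ob C" and y: "y \<in> Ob C" and f: "f \<in> Hom C x y"
    have Fx: "fob F x \<in> Ob D" and gFx: "g (fob F x) \<in> Ob C"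
      and Fy: "fob F y \<in> Ob D" and gFy: "g (fob F y) \<in> Ob C" using x y F.fob_closed g by auto
    let ?k = "r (fob F x) (fob F y) (farr F x y f)"
    have k: "?k \<in> Hom C (g (fob F x)) (g (fob F y))"
      by (intro r_hom Fx Fy F.farr_hom x y f)
    have "Comp C (g (fob F x)) (g (fob F y)) y (\<theta> y) ?k = Comp C (g (fob F x)) x y f (\<theta> x)"
    proof (rule faithful[OF gFx y C.comp_hom[OF gFx gFy y k \<theta>[OF y]] C.comp_hom[OF gFx x y \<theta>[OF x] f]])
      show "farr F (g (fob F x)) y (Comp C (g (fob F x)) (g (fob F y)) y (\<theta> y) ?k) =
        farr F (g (fob F x)) y (Comp C (g (fob F x)) x y f (\<theta> x))"
        using adj_r[OF Fx Fy F.farr_hom[OF x y f]]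
        by (simp add: F.farr_comp[OF gFx gFy y k \<theta>[OF y]] F.farr_comp[OF gFx x y \<theta>[OF x] f]
            F\<theta>[OF x] F\<theta>[OF y] adj_def)
    qed
    then show "Comp C (fob (functor_comp G F) x) (fob (functor_comp G F) y) (fob functor_id y) (\<theta> y)
         (farr (functor_comp G F) x y f) =
        Comp C (fob (functor_comp G F) x) (fob functor_id x) (fob functor_id y) (farr functor_id x y f) (\<theta> x)"
      by (simp add: functor_comp_def functor_id_def G_def)
  qed
  show ?thesis
    unfolding equivalent_categories_def using catC catD functorF functorG GF FG by blast
qed

lemma covering_cat_category:
  assumes "is_category C" and X: "X \<in> Ob C"
  shows "is_category (covering_cat C cov X)"
proof -
  interpret is_category C by fact
  show ?thesis
    by unfold_locales
       (auto simp: covering_cat_def ident_hom comp_ident ident_comp comp_assoc comp_hom X)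
qed

text \<open>Over $X$ the functor acts by $(Y, p) \mapsto (F Y, F p)$. It is full because a lift of a morphism over
  $F X$ is a morphism over $X$ by faithfulness. A covering $p : d \to F X$ is reached by
  choosing $k : F Y \cong d$ and lifting $p \circ k$ to a morphism $Y \to X$, which is a covering because $F$
  reflects coverings.\<close>

theorem covering_cat_equivalence:
  fixes C :: "('o, 'm) cat" and D :: "('o2, 'm2) cat"
  assumes catC: "is_category C" and catD: "is_category D" and functorF: "is_functor C D F"
    and ff: "fully_faithful C D F" and es: "essentially_surjective C D F"
    and X: "X \<in> Ob C"
    and cov_iff: "\<And>Y p. Y \<in> Ob C \<Longrightarrow> p \<in> Hom C Y X \<Longrightarrow>
      covD (fob F Y) (fob F X) (farr F Y X p) \<longleftrightarrow> covC Y X p"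
    and cov_iso: "\<And>c d k p. c \<in> Ob D \<Longrightarrow> d \<in> Ob D \<Longrightarrow> k \<in> cat_iso D c d \<Longrightarrow> p \<in> Hom D d (fob F X) \<Longrightarrow>
      covD d (fob F X) p \<Longrightarrow> covD c (fob F X) (Comp D c d (fob F X) p k)"
  shows "equivalent_categories (covering_cat C covC X) (covering_cat D covD (fob F X))"
proof -
  interpret C: is_category C by fact
  interpret D: is_category D by fact
  interpret F: is_functor C D F by fact
  have FX: "fob F X \<in> Ob D" by (rule F.fob_closed[OF X])
  let ?C = "covering_cat C covC X" and ?D = "covering_cat D covD (fob F X)"
  define F' where "F' = \<lparr>fob = (\<lambda>(Y, p). (fob F Y, farr F Y X p)), farr = (\<lambda>(Y, p) (Z, q). farr F Y Z)\<rparr>"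
  have "is_functor ?C ?D F'"
    by unfold_locales
       (auto simp: covering_cat_def F'_def X F.fob_closed F.farr_hom F.farr_ident F.farr_comp cov_iff)
  moreover have "fully_faithful ?C ?D F'"
    unfolding fully_faithful_def
  proof clarify
    fix Y p Z q assume "(Y, p) \<in> Ob ?C" and "(Z, q) \<in> Ob ?C"
    then have Y: "Y \<in> Ob C" "p \<in> Hom C Y X" and Z: "Z \<in> Ob C" "q \<in> Hom C Z X"
      by (auto simp: covering_cat_def)
    have bij: "bij_betw (farr F Y Z) (Hom C Y Z) (Hom D (fob F Y) (fob F Z))"
      and inj: "inj_on (farr F Y X) (Hom C Y X)"
      using ff X Y Z unfolding fully_faithful_def bij_betw_def by blast+
    have over: "Comp D (fob F Y) (fob F Z) (fob F X) (farr F Z X q) (farr F Y Z h) = farr F Y X p \<longleftrightarrow>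
        Comp C Y Z X q h = p" if "h \<in> Hom C Y Z" for h
      using F.farr_comp[OF Y(1) Z(1) X that Z(2)] inj_on_eq_iff[OF inj _ Y(2)]
        C.comp_hom[OF Y(1) Z(1) X that Z(2)] by metis
    have "bij_betw (farr F Y Z) {h \<in> Hom C Y Z. Comp C Y Z X q h = p}
      {h \<in> Hom D (fob F Y) (fob F Z). Comp D (fob F Y) (fob F Z) (fob F X) (farr F Z X q) h = farr F Y X p}"
      by (rule bij_betw_subset[OF bij, of "{h \<in> Hom C Y Z. Comp C Y Z X q h = p}", simplified])
         (use over bij_betw_imp_surj_on[OF bij, symmetric] in auto)
    then show "bij_betw (farr F' (Y, p) (Z, q)) (Hom ?C (Y, p) (Z, q)) (Hom ?D (fob F' (Y, p)) (fob F' (Z, q)))"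
      by (simp add: F'_def covering_cat_def)
  qed
  moreover have "essentially_surjective ?C ?D F'"
    unfolding essentially_surjective_def
  proof clarify
    fix d p assume "(d, p) \<in> Ob ?D"
    then have d: "d \<in> Ob D" and p: "p \<in> Hom D d (fob F X)" and cov: "covD d (fob F X) p"
      by (auto simp: covering_cat_def)
    obtain Y k where Y: "Y \<in> Ob C" and k: "k \<in> cat_iso D (fob F Y) d"
      using es d unfolding essentially_surjective_def by blast
    have FY: "fob F Y \<in> Ob D" by (rule F.fob_closed[OF Y])
    obtain k' where khom: "k \<in> Hom D (fob F Y) d" and k': "k' \<in> Hom D d (fob F Y)"
      and k'k: "Comp D (fob F Y) d (fob F Y) k' k = Ident D (fob F Y)"
      and kk': "Comp D d (fob F Y) d k k' = Ident D d"
      using k by (auto simp: cat_iso_def)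
    let ?pk = "Comp D (fob F Y) d (fob F X) p k"
    have "?pk \<in> Hom D (fob F Y) (fob F X)" by (rule D.comp_hom[OF FY d FX khom p])
    moreover have "farr F Y X ` Hom C Y X = Hom D (fob F Y) (fob F X)"
      using ff Y X unfolding fully_faithful_def bij_betw_def by blast
    ultimately obtain q where q: "q \<in> Hom C Y X" and Fq: "farr F Y X q = ?pk"
      by (metis imageE)
    have "covD (fob F Y) (fob F X) (farr F Y X q)"
      unfolding Fq by (rule cov_iso[OF FY d k p cov])
    then have "covC Y X q" using cov_iff[OF Y q] by simp
    then have "(Y, q) \<in> Ob ?C" using Y q by (simp add: covering_cat_def)
    moreover have "Comp D d (fob F Y) (fob F X) ?pk k' = p"
      using D.comp_assoc[OF d FY d FX k' khom p] kk' D.comp_ident[OF d FX p] by simp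
    then have "k \<in> cat_iso ?D (fob F' (Y, q)) (d, p)"
      using khom k' k'k kk' by (auto simp: cat_iso_def covering_cat_def F'_def Fq intro!: bexI[of _ k'])
    ultimately show "\<exists>x\<in>Ob ?C. cat_iso ?D (fob F' x) (d, p) \<noteq> {}" by blast
  qed
  ultimately show ?thesis
    by (intro fully_faithful_essentially_surjective_equivalence covering_cat_category catC catD X FX)
qed

section \<open>The algebra of groups with operations\<close>

locale gwo_algebra = groups_with_operations T + gwo_object T A
  for T :: "('p, 'q) gwo_theory" and A :: "('a, 'p, 'q) gwo"
begin

lemmas closed = zero_closed neg_closed add_closed unop_closed binop_closed

text \<open>The laws required of a theory use the variables 0, 1 and 2 only, so an assignment of three
  elements suffices to read them off.\<close>

lemma ident_instance:
  assumes "(l, r) \<in> idents T" "x \<in> carr A" "y \<in> carr A" "z \<in> carr A"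
  defines "v \<equiv> \<lambda>n::nat. if n = 0 then x else if n = 1 then y else z"
  shows "gval A v l = gval A v r"
  by (rule satisfies) (use assms in auto)

lemma group_ident_instance:
  assumes "(l, r) \<in> group_idents" "x \<in> carr A" "y \<in> carr A" "z \<in> carr A"
  defines "v \<equiv> \<lambda>n::nat. if n = 0 then x else if n = 1 then y else z"
  shows "gval A v l = gval A v r"
  unfolding v_def by (rule ident_instance) (use assms group_laws in auto)

lemma add_assoc:
  "x \<in> carr A \<Longrightarrow> y \<in> carr A \<Longrightarrow> z \<in> carr A \<Longrightarrow> x \<oplus>\<^bsub>A\<^esub> y \<oplus>\<^bsub>A\<^esub> z = x \<oplus>\<^bsub>A\<^esub> (y \<oplus>\<^bsub>A\<^esub> z)"
  using group_ident_instance[of "TAdd (TAdd (TVar 0) (TVar 1)) (TVar 2)"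
      "TAdd (TVar 0) (TAdd (TVar 1) (TVar 2))" x y z]
  by (simp add: group_idents_def)

lemma zero_add: "x \<in> carr A \<Longrightarrow> \<zero>\<^bsub>A\<^esub> \<oplus>\<^bsub>A\<^esub> x = x"
  using group_ident_instance[of "TAdd TZero (TVar 0)" "TVar 0" x x x] by (simp add: group_idents_def)

lemma add_zero: "x \<in> carr A \<Longrightarrow> x \<oplus>\<^bsub>A\<^esub> \<zero>\<^bsub>A\<^esub> = x"
  using group_ident_instance[of "TAdd (TVar 0) TZero" "TVar 0" x x x] by (simp add: group_idents_def)

lemma neg_add: "x \<in> carr A \<Longrightarrow> (\<ominus>\<^bsub>A\<^esub> x) \<oplus>\<^bsub>A\<^esub> x = \<zero>\<^bsub>A\<^esub>"
  using group_ident_instance[of "TAdd (TNeg (TVar 0)) (TVar 0)" TZero x x x] by (simp add: group_idents_def)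

lemma add_neg: "x \<in> carr A \<Longrightarrow> x \<oplus>\<^bsub>A\<^esub> (\<ominus>\<^bsub>A\<^esub> x) = \<zero>\<^bsub>A\<^esub>"
  using group_ident_instance[of "TAdd (TVar 0) (TNeg (TVar 0))" TZero x x x] by (simp add: group_idents_def)

lemma neg_add_cancel: "x \<in> carr A \<Longrightarrow> y \<in> carr A \<Longrightarrow> (\<ominus>\<^bsub>A\<^esub> x) \<oplus>\<^bsub>A\<^esub> (x \<oplus>\<^bsub>A\<^esub> y) = y"
  by (simp add: add_assoc[symmetric] closed neg_add zero_add)

lemma add_neg_cancel: "x \<in> carr A \<Longrightarrow> y \<in> carr A \<Longrightarrow> x \<oplus>\<^bsub>A\<^esub> ((\<ominus>\<^bsub>A\<^esub> x) \<oplus>\<^bsub>A\<^esub> y) = y"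
  by (simp add: add_assoc[symmetric] closed add_neg zero_add)

lemma left_cancel:
  "x \<in> carr A \<Longrightarrow> y \<in> carr A \<Longrightarrow> z \<in> carr A \<Longrightarrow> x \<oplus>\<^bsub>A\<^esub> y = x \<oplus>\<^bsub>A\<^esub> z \<longleftrightarrow> y = z"
  by (metis neg_add_cancel)

lemma idempotent_is_zero: "x \<in> carr A \<Longrightarrow> x \<oplus>\<^bsub>A\<^esub> x = x \<longleftrightarrow> x = \<zero>\<^bsub>A\<^esub>"
  by (metis add_zero left_cancel zero_closed)

lemma neg_unique: "x \<in> carr A \<Longrightarrow> y \<in> carr A \<Longrightarrow> x \<oplus>\<^bsub>A\<^esub> y = \<zero>\<^bsub>A\<^esub> \<Longrightarrow> y = \<ominus>\<^bsub>A\<^esub> x"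
  by (metis add_neg left_cancel neg_closed)

lemma neg_neg: "x \<in> carr A \<Longrightarrow> \<ominus>\<^bsub>A\<^esub> (\<ominus>\<^bsub>A\<^esub> x) = x"
  by (metis neg_add neg_closed neg_unique)

lemma neg_zero: "\<ominus>\<^bsub>A\<^esub> \<zero>\<^bsub>A\<^esub> = \<zero>\<^bsub>A\<^esub>"
  by (metis add_zero neg_unique zero_closed)

lemma neg_distrib: "x \<in> carr A \<Longrightarrow> y \<in> carr A \<Longrightarrow> \<ominus>\<^bsub>A\<^esub> (x \<oplus>\<^bsub>A\<^esub> y) = (\<ominus>\<^bsub>A\<^esub> y) \<oplus>\<^bsub>A\<^esub> (\<ominus>\<^bsub>A\<^esub> x)"
  by (rule neg_unique[symmetric]) (simp_all add: closed add_assoc add_neg_cancel add_neg)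

lemmas group_simps = closed add_assoc zero_add add_zero neg_add add_neg neg_add_cancel add_neg_cancel
  neg_neg neg_zero neg_distrib

lemma unop_zero: "w \<in> unops T \<Longrightarrow> unop A w \<zero>\<^bsub>A\<^esub> = \<zero>\<^bsub>A\<^esub>"
  using ident_instance[OF unop_add_law zero_closed zero_closed zero_closed, of w]
  by (simp add: idempotent_is_zero[symmetric] closed zero_add)

lemma unop_add:
  "w \<in> unops T \<Longrightarrow> x \<in> carr A \<Longrightarrow> y \<in> carr A \<Longrightarrow> unop A w (x \<oplus>\<^bsub>A\<^esub> y) = unop A w x \<oplus>\<^bsub>A\<^esub> unop A w y"
  using ident_instance[OF unop_add_law, of w x y y] by simp

lemma binop_opp:
  "q \<in> binops T \<Longrightarrow> x \<in> carr A \<Longrightarrow> y \<in> carr A \<Longrightarrow> binop A (opp T q) x y = binop A q y x"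
  using ident_instance[OF opp_law, of q x y y] by simp

lemma distrib_left:
  "q \<in> binops T \<Longrightarrow> x \<in> carr A \<Longrightarrow> y \<in> carr A \<Longrightarrow> z \<in> carr A \<Longrightarrow>
   binop A q x (y \<oplus>\<^bsub>A\<^esub> z) = binop A q x y \<oplus>\<^bsub>A\<^esub> binop A q x z"
  using ident_instance[OF distrib_law, of q x y z] by simp

lemma distrib_right:
  assumes "q \<in> binops T" "x \<in> carr A" "y \<in> carr A" "z \<in> carr A"
  shows "binop A q (x \<oplus>\<^bsub>A\<^esub> y) z = binop A q x z \<oplus>\<^bsub>A\<^esub> binop A q y z"
  using distrib_left[OF opp_closed, of q z x y] assms by (simp add: binop_opp closed)

text \<open>This order of the four products is the one that occurs in the semidirect product. Distributing
  over the second argument first gives another order, so the two middle products commute,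
  although addition need not be commutative.\<close>

lemma distrib_both:
  assumes "q \<in> binops T" "x \<in> carr A" "y \<in> carr A" "x' \<in> carr A" "y' \<in> carr A"
  shows "binop A q (x \<oplus>\<^bsub>A\<^esub> y) (x' \<oplus>\<^bsub>A\<^esub> y') =
    binop A q x x' \<oplus>\<^bsub>A\<^esub> binop A q x y' \<oplus>\<^bsub>A\<^esub> (binop A q y x' \<oplus>\<^bsub>A\<^esub> binop A q y y')"
  by (subst distrib_right) (simp_all add: assms distrib_left closed)

lemma binop_zero_right: "q \<in> binops T \<Longrightarrow> x \<in> carr A \<Longrightarrow> binop A q x \<zero>\<^bsub>A\<^esub> = \<zero>\<^bsub>A\<^esub>"
  using distrib_left[of q x "\<zero>\<^bsub>A\<^esub>" "\<zero>\<^bsub>A\<^esub>"]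
  by (simp add: idempotent_is_zero[symmetric] closed zero_add)

lemma binop_zero_left: "q \<in> binops T \<Longrightarrow> x \<in> carr A \<Longrightarrow> binop A q \<zero>\<^bsub>A\<^esub> x = \<zero>\<^bsub>A\<^esub>"
  using distrib_right[of q "\<zero>\<^bsub>A\<^esub>" "\<zero>\<^bsub>A\<^esub>" x]
  by (simp add: idempotent_is_zero[symmetric] closed zero_add)

lemma binop_neg_right:
  assumes "q \<in> binops T" "x \<in> carr A" "y \<in> carr A"
  shows "binop A q x (\<ominus>\<^bsub>A\<^esub> y) = \<ominus>\<^bsub>A\<^esub> (binop A q x y)"
  using distrib_left[of q x y "\<ominus>\<^bsub>A\<^esub> y"] assms
  by (intro neg_unique) (simp_all add: closed add_neg binop_zero_right)

end

lemma gwo_homD: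
  assumes "f \<in> gwo_hom T A B"
  shows "x \<in> carr A \<Longrightarrow> f x \<in> carr B"
    and "x \<in> carr A \<Longrightarrow> y \<in> carr A \<Longrightarrow> f (x \<oplus>\<^bsub>A\<^esub> y) = f x \<oplus>\<^bsub>B\<^esub> f y"
    and "w \<in> unops T \<Longrightarrow> x \<in> carr A \<Longrightarrow> f (unop A w x) = unop B w (f x)"
    and "q \<in> binops T \<Longrightarrow> x \<in> carr A \<Longrightarrow> y \<in> carr A \<Longrightarrow> f (binop A q x y) = binop B q (f x) (f y)"
  using assms by (auto simp: gwo_hom_def)

lemma gwo_hom_extensional: "f \<in> gwo_hom T A B \<Longrightarrow> f \<in> extensional (carr A)"
  by (auto simp: gwo_hom_def PiE_def)

lemma gwo_hom_zero:
  assumes "gwo_algebra T A" "gwo_algebra T B" and f: "f \<in> gwo_hom T A B"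
  shows "f \<zero>\<^bsub>A\<^esub> = \<zero>\<^bsub>B\<^esub>"
proof -
  interpret A: gwo_algebra T A by fact
  interpret B: gwo_algebra T B by fact
  show ?thesis
    using gwo_homD(2)[OF f A.zero_closed A.zero_closed] gwo_homD(1)[OF f A.zero_closed]
    by (metis A.add_zero A.zero_closed B.idempotent_is_zero)
qed

lemma gwo_hom_neg:
  assumes "gwo_algebra T A" "gwo_algebra T B" and f: "f \<in> gwo_hom T A B" and x: "x \<in> carr A"
  shows "f (\<ominus>\<^bsub>A\<^esub> x) = \<ominus>\<^bsub>B\<^esub> f x"
proof -
  interpret A: gwo_algebra T A by fact
  interpret B: gwo_algebra T B by fact
  show ?thesis
    using gwo_homD(2)[OF f x A.neg_closed[OF x]] gwo_homD(1)[OF f] x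
    by (intro B.neg_unique) (simp_all add: A.group_simps gwo_hom_zero[OF assms(1,2) f])
qed

lemma gwo_iso_iff_bij:
  assumes "gwo_object T A"
  shows "f \<in> gwo_iso T A B \<longleftrightarrow> f \<in> gwo_hom T A B \<and> bij_betw f (carr A) (carr B)"
proof
  assume "f \<in> gwo_iso T A B"
  then obtain g where f: "f \<in> gwo_hom T A B" and g: "g \<in> gwo_hom T B A"
    and gf: "\<forall>x\<in>carr A. g (f x) = x" and fg: "\<forall>y\<in>carr B. f (g y) = y"
    by (auto simp: gwo_iso_def)
  then show "f \<in> gwo_hom T A B \<and> bij_betw f (carr A) (carr B)"
    by (auto intro!: bij_betw_byWitness[where f' = g] gwo_homD(1)[OF f] gwo_homD(1)[OF g])
next
  interpret gwo_object T A by fact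
  assume "f \<in> gwo_hom T A B \<and> bij_betw f (carr A) (carr B)"
  then have f: "f \<in> gwo_hom T A B" and bij: "bij_betw f (carr A) (carr B)" by auto
  define g where "g = restrict (inv_into (carr A) f) (carr B)"
  have gc: "g y \<in> carr A" if "y \<in> carr B" for y
    using bij that by (auto simp: g_def bij_betw_def inv_into_into)
  have fg: "f (g y) = y" if "y \<in> carr B" for y
    using bij that by (simp add: g_def bij_betw_inv_into_right)
  have gf: "g (f x) = x" if "x \<in> carr A" for x
    using bij that gwo_homD(1)[OF f] by (simp add: g_def bij_betw_inv_into_left)
  have "g (y \<oplus>\<^bsub>B\<^esub> z) = g y \<oplus>\<^bsub>A\<^esub> g z" if "y \<in> carr B" "z \<in> carr B" for y z
    using gf[OF add_closed[OF gc[OF that(1)] gc[OF that(2)]]] gwo_homD(2)[OF f gc gc] that by (simp add: fg)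
  moreover have "g (unop B w y) = unop A w (g y)" if "w \<in> unops T" "y \<in> carr B" for w y
    using gf[OF unop_closed[OF that(1) gc[OF that(2)]]] gwo_homD(3)[OF f _ gc] that by (simp add: fg)
  moreover have "g (binop B q y z) = binop A q (g y) (g z)" if "q \<in> binops T" "y \<in> carr B" "z \<in> carr B" for q y z
    using gf[OF binop_closed[OF that(1) gc[OF that(2)] gc[OF that(3)]]] gwo_homD(4)[OF f _ gc gc] that by (simp add: fg)
  ultimately have "g \<in> gwo_hom T B A"
    using gc by (auto simp: gwo_hom_def g_def)
  then show "f \<in> gwo_iso T A B"
    using f fg gf by (auto simp: gwo_iso_def)
qed

text \<open>Identities are inherited along injective maps that preserve the operations, since such a map
  commutes with the evaluation of terms. Semidirect products and transported subobjects both
  become objects in this way, without any identity being inspected. Evaluation is compared on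
  well-formed terms only, because nothing is known about symbols outside the signature.\<close>

lemma gwo_object_if_embedded:
  fixes A :: "('a, 'p, 'q) gwo"
  assumes "groups_with_operations T" and "gwo_object T B"
    and inj: "inj_on f (carr A)" and into: "f ` carr A \<subseteq> carr B"
    and zero: "\<zero>\<^bsub>A\<^esub> \<in> carr A" "f \<zero>\<^bsub>A\<^esub> = \<zero>\<^bsub>B\<^esub>"
    and neg: "\<And>x. x \<in> carr A \<Longrightarrow> \<ominus>\<^bsub>A\<^esub> x \<in> carr A \<and> f (\<ominus>\<^bsub>A\<^esub> x) = \<ominus>\<^bsub>B\<^esub> f x"
    and add: "\<And>x y. x \<in> carr A \<Longrightarrow> y \<in> carr A \<Longrightarrow> x \<oplus>\<^bsub>A\<^esub> y \<in> carr A \<and> f (x \<oplus>\<^bsub>A\<^esub> y) = f x \<oplus>\<^bsub>B\<^esub> f y"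
    and unop: "\<And>w x. w \<in> unops T \<Longrightarrow> x \<in> carr A \<Longrightarrow> unop A w x \<in> carr A \<and> f (unop A w x) = unop B w (f x)"
    and binop: "\<And>q x y. q \<in> binops T \<Longrightarrow> x \<in> carr A \<Longrightarrow> y \<in> carr A \<Longrightarrow>
      binop A q x y \<in> carr A \<and> f (binop A q x y) = binop B q (f x) (f y)"
  shows "gwo_object T A"
proof -
  interpret groups_with_operations T by fact
  interpret B: gwo_object T B by fact
  have val: "gval A v t \<in> carr A \<and> f (gval A v t) = gval B (f \<circ> v) t"
    if "range v \<subseteq> carr A" "wf_gterm T t" for v t
    using that(2) by (induction t) (use that(1) zero neg add unop binop in auto)
  show ?thesis
  proof
    fix l r and v :: "nat \<Rightarrow> 'a" assume lr: "(l, r) \<in> idents T" and v: "range v \<subseteq> carr A"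
    have "gval B (f \<circ> v) l = gval B (f \<circ> v) r"
      by (rule B.satisfies[OF lr]) (use v into in auto)
    then show "gval A v l = gval A v r"
      using val[OF v] idents_wf[OF lr] inj_onD[OF inj] by metis
  qed (use zero neg add unop binop in auto)
qed

lemma gwo_hom_compose:
  assumes f: "f \<in> gwo_hom T A B" and g: "g \<in> gwo_hom T B C" and "gwo_object T A"
  shows "compose (carr A) g f \<in> gwo_hom T A C"
proof -
  interpret gwo_object T A by fact
  show ?thesis
    using gwo_homD[OF f] gwo_homD[OF g]
    by (simp add: gwo_hom_def compose_def add_closed unop_closed binop_closed)
qed

lemma gwo_hom_ident: "gwo_object T A \<Longrightarrow> restrict (\<lambda>x. x) (carr A) \<in> gwo_hom T A A"
  by (simp add: gwo_hom_def gwo_object.add_closed gwo_object.unop_closed gwo_object.binop_closed)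

section \<open>Split extensions and semidirect products\<close>

text \<open>Here $A \xrightarrow{i} E \xrightarrow{p} B$ is an extension split by $s$, and \<open>dot\<close> and \<open>star\<close> are the
  derived actions that it induces. The type of $E$ is left open: for a crossed module it is the
  square of the type of $A$ and $B$, as in the definition of derived actions, and for a
  cat$^1$-group $G$ the middle term is $G$ itself.\<close>

locale split_extension =
  A: gwo_algebra T A + B: gwo_algebra T B + E: gwo_algebra T E
  for T :: "('p, 'q) gwo_theory" and A :: "('a, 'p, 'q) gwo" and B :: "('a, 'p, 'q) gwo"
    and E :: "('e, 'p, 'q) gwo" +
  fixes dot star i p s
  assumes dot_closed: "b \<in> carr B \<Longrightarrow> a \<in> carr A \<Longrightarrow> dot b a \<in> carr A"
    and star_closed: "q \<in> binops T \<Longrightarrow> b \<in> carr B \<Longrightarrow> a \<in> carr A \<Longrightarrow> star q b a \<in> carr A"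
    and i_hom: "i \<in> gwo_hom T A E" and i_inj: "inj_on i (carr A)"
    and i_image: "i ` carr A = gwo_ker E B p"
    and p_hom: "p \<in> gwo_hom T E B"
    and s_hom: "s \<in> gwo_hom T B E" and ps: "b \<in> carr B \<Longrightarrow> p (s b) = b"
    and i_dot: "b \<in> carr B \<Longrightarrow> a \<in> carr A \<Longrightarrow> i (dot b a) = s b \<oplus>\<^bsub>E\<^esub> i a \<oplus>\<^bsub>E\<^esub> (\<ominus>\<^bsub>E\<^esub> s b)"
    and i_star: "q \<in> binops T \<Longrightarrow> b \<in> carr B \<Longrightarrow> a \<in> carr A \<Longrightarrow> i (star q b a) = binop E q (s b) (i a)"
begin

lemmas i_simps = gwo_homD[OF i_hom] gwo_hom_zero[OF A.gwo_algebra_axioms E.gwo_algebra_axioms i_hom]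
  gwo_hom_neg[OF A.gwo_algebra_axioms E.gwo_algebra_axioms i_hom] i_dot i_star
lemmas p_simps = gwo_homD[OF p_hom] gwo_hom_zero[OF E.gwo_algebra_axioms B.gwo_algebra_axioms p_hom]
  gwo_hom_neg[OF E.gwo_algebra_axioms B.gwo_algebra_axioms p_hom] ps
lemmas s_simps = gwo_homD[OF s_hom] gwo_hom_zero[OF B.gwo_algebra_axioms E.gwo_algebra_axioms s_hom]
  gwo_hom_neg[OF B.gwo_algebra_axioms E.gwo_algebra_axioms s_hom]
lemmas closure = A.closed B.closed E.closed dot_closed star_closed gwo_homD(1)[OF i_hom]
  gwo_homD(1)[OF s_hom] A.opp_closed

lemma p_i: "a \<in> carr A \<Longrightarrow> p (i a) = \<zero>\<^bsub>B\<^esub>"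
  using i_image by (auto simp: gwo_ker_def)

abbreviation "S \<equiv> semidirect T A B dot star"

lemma S_closed:
  shows "\<zero>\<^bsub>S\<^esub> \<in> carr S"
    and "x \<in> carr S \<Longrightarrow> \<ominus>\<^bsub>S\<^esub> x \<in> carr S"
    and "x \<in> carr S \<Longrightarrow> y \<in> carr S \<Longrightarrow> x \<oplus>\<^bsub>S\<^esub> y \<in> carr S"
    and "w \<in> unops T \<Longrightarrow> x \<in> carr S \<Longrightarrow> unop S w x \<in> carr S"
    and "q \<in> binops T \<Longrightarrow> x \<in> carr S \<Longrightarrow> y \<in> carr S \<Longrightarrow> binop S q x y \<in> carr S"
  by (auto simp: semidirect_def closure)

text \<open>The comparison $A \rtimes B \cong E$ that every split extension induces. Along it the semidirect
  product inherits the identities of the theory from $E$.\<close>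

definition split_sum where "split_sum = restrict (\<lambda>(a, b). i a \<oplus>\<^bsub>E\<^esub> s b) (carr A \<times> carr B)"

lemma split_sum_apply: "a \<in> carr A \<Longrightarrow> b \<in> carr B \<Longrightarrow> split_sum (a, b) = i a \<oplus>\<^bsub>E\<^esub> s b"
  by (simp add: split_sum_def)

lemma split_sum_zero: "split_sum \<zero>\<^bsub>S\<^esub> = \<zero>\<^bsub>E\<^esub>"
  by (simp add: semidirect_def split_sum_apply closure i_simps s_simps E.zero_add)

lemma split_sum_neg: "x \<in> carr S \<Longrightarrow> split_sum (\<ominus>\<^bsub>S\<^esub> x) = \<ominus>\<^bsub>E\<^esub> split_sum x"
  by (auto simp: semidirect_def split_sum_apply closure i_simps s_simps E.group_simps)

lemma split_sum_add: "x \<in> carr S \<Longrightarrow> y \<in> carr S \<Longrightarrow> split_sum (x \<oplus>\<^bsub>S\<^esub> y) = split_sum x \<oplus>\<^bsub>E\<^esub> split_sum y"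
  by (auto simp: semidirect_def split_sum_apply closure i_simps s_simps E.group_simps)

lemma split_sum_unop: "w \<in> unops T \<Longrightarrow> x \<in> carr S \<Longrightarrow> split_sum (unop S w x) = unop E w (split_sum x)"
  by (auto simp: semidirect_def split_sum_apply closure i_simps s_simps E.unop_add)

text \<open>The second summand in the product of the semidirect product is $s(b) \star^\circ i(a')$, that is,
  $i(a') \star s(b)$.\<close>

lemma split_sum_binop:
  "q \<in> binops T \<Longrightarrow> x \<in> carr S \<Longrightarrow> y \<in> carr S \<Longrightarrow>
   split_sum (binop S q x y) = binop E q (split_sum x) (split_sum y)"
  by (auto simp: semidirect_def split_sum_apply closure i_simps s_simps E.group_simps E.binop_opp
      E.distrib_both)

text \<open>Every $e$ is uniquely the sum of $e - s(p\,e)$, which lies in $\ker p = i(A)$, and an element of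
  $s(B)$.\<close>

lemma split_sum_bij: "bij_betw split_sum (carr S) (carr E)"
proof -
  define r where "r e = e \<oplus>\<^bsub>E\<^esub> (\<ominus>\<^bsub>E\<^esub> s (p e))" for e
  have r_ker: "r e \<in> i ` carr A" if "e \<in> carr E" for e
    using that unfolding i_image gwo_ker_def by (simp add: r_def closure p_simps B.add_neg)
  have "inj_on split_sum (carr S)"
  proof (rule inj_onI, clarify)
    fix a b a' b' assume "(a, b) \<in> carr S" "(a', b') \<in> carr S" and eq: "split_sum (a, b) = split_sum (a', b')"
    then have c: "a \<in> carr A" "b \<in> carr B" "a' \<in> carr A" "b' \<in> carr B" by (auto simp: semidirect_def)
    \<comment> \<open>$p$ recovers the second component; the first is found by cancelling $s(b)$.\<close>
    have "p (split_sum (a, b)) = b" "p (split_sum (a', b')) = b'"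
      using c by (simp_all add: split_sum_apply p_simps closure p_i B.zero_add)
    then have b: "b = b'" using eq by simp
    have "(i a \<oplus>\<^bsub>E\<^esub> s b) \<oplus>\<^bsub>E\<^esub> (\<ominus>\<^bsub>E\<^esub> s b) = (i a' \<oplus>\<^bsub>E\<^esub> s b) \<oplus>\<^bsub>E\<^esub> (\<ominus>\<^bsub>E\<^esub> s b)"
      using eq c b by (simp add: split_sum_apply)
    then have "i a = i a'" using c by (simp add: E.group_simps closure)
    then show "a = a' \<and> b = b'" using b c i_inj by (auto dest: inj_onD)
  qed
  moreover have "split_sum ` carr S \<subseteq> carr E"
    by (auto simp: semidirect_def split_sum_apply closure)
  moreover have "e \<in> split_sum ` carr S" if e: "e \<in> carr E" for e
  proof -
    obtain a where a: "a \<in> carr A" "r e = i a" using r_ker[OF e] by auto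
    have "split_sum (a, p e) = e"
      using a e by (simp add: split_sum_apply p_simps a(2)[symmetric] r_def E.group_simps closure)
    moreover have "(a, p e) \<in> carr S" using a e by (simp add: semidirect_def p_simps)
    ultimately show ?thesis by (metis imageI)
  qed
  ultimately show ?thesis unfolding bij_betw_def by blast
qed

theorem semidirect_object: "gwo_object T S"
proof (rule gwo_object_if_embedded[where f = split_sum])
  show "inj_on split_sum (carr S)" "split_sum ` carr S \<subseteq> carr E" using split_sum_bij by (auto simp: bij_betw_def)
qed (use S_closed split_sum_zero split_sum_neg split_sum_add split_sum_unop split_sum_binop
    A.groups_with_operations_axioms E.gwo_object_axioms in auto)

theorem split_sum_iso: "split_sum \<in> gwo_iso T S E"
proof -
  have "split_sum \<in> carr S \<rightarrow>\<^sub>E carr E"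
    using split_sum_bij by (auto simp: bij_betw_def PiE_def extensional_def split_sum_def semidirect_def)
  then show ?thesis
    using split_sum_bij by (simp add: gwo_iso_iff_bij[OF semidirect_object] gwo_hom_def
        split_sum_add split_sum_unop split_sum_binop)
qed

lemma dot_zero_left: "a \<in> carr A \<Longrightarrow> dot \<zero>\<^bsub>B\<^esub> a = a"
  by (rule inj_onD[OF i_inj]) (simp_all add: closure i_simps s_simps E.group_simps)

lemma dot_zero_right: "b \<in> carr B \<Longrightarrow> dot b \<zero>\<^bsub>A\<^esub> = \<zero>\<^bsub>A\<^esub>"
  by (rule inj_onD[OF i_inj]) (simp_all add: closure i_simps s_simps E.group_simps)

lemma star_zero_left: "q \<in> binops T \<Longrightarrow> a \<in> carr A \<Longrightarrow> star q \<zero>\<^bsub>B\<^esub> a = \<zero>\<^bsub>A\<^esub>"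
  by (rule inj_onD[OF i_inj]) (simp_all add: closure i_simps s_simps E.binop_zero_left)

lemma star_zero_right: "q \<in> binops T \<Longrightarrow> b \<in> carr B \<Longrightarrow> star q b \<zero>\<^bsub>A\<^esub> = \<zero>\<^bsub>A\<^esub>"
  by (rule inj_onD[OF i_inj]) (simp_all add: closure i_simps s_simps E.binop_zero_right)

end

section \<open>From crossed modules to cat$^1$-groups\<close>

locale gwo_crossed_module = groups_with_operations T
  for T :: "('p, 'q) gwo_theory" +
  fixes X :: "('a, 'p, 'q) xmod"
  assumes xmod: "crossed_module T X"
begin

abbreviation "A \<equiv> xdom X"
abbreviation "B \<equiv> xcod X"
abbreviation "S \<equiv> semidirect T A B (xdot X) (xstar X)"

sublocale A: gwo_algebra T A
  by (intro gwo_algebra.intro groups_with_operations_axioms crossed_module.dom_object[OF xmod])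

sublocale B: gwo_algebra T B
  by (intro gwo_algebra.intro groups_with_operations_axioms crossed_module.cod_object[OF xmod])

lemma split_extension_exists:
  "\<exists>(E :: ('a \<times> 'a, 'p, 'q) gwo) i p s. split_extension T A B E (xdot X) (xstar X) i p s"
proof -
  from crossed_module.actions[OF xmod]
  obtain E :: "('a \<times> 'a, 'p, 'q) gwo" and i p s where E: "gwo_object T E"
    and ips: "i \<in> gwo_hom T A E" "inj_on i (carr A)" "i ` carr A = gwo_ker E B p"
      "p \<in> gwo_hom T E B" "s \<in> gwo_hom T B E" "\<forall>b\<in>carr B. p (s b) = b"
      "\<forall>b\<in>carr B. \<forall>a\<in>carr A. xdot X b a \<in> carr A"
      "\<forall>q\<in>binops T. \<forall>b\<in>carr B. \<forall>a\<in>carr A. xstar X q b a \<in> carr A"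
      "\<forall>b\<in>carr B. \<forall>a\<in>carr A. i (xdot X b a) = s b \<oplus>\<^bsub>E\<^esub> i a \<oplus>\<^bsub>E\<^esub> (\<ominus>\<^bsub>E\<^esub> s b)"
      "\<forall>q\<in>binops T. \<forall>b\<in>carr B. \<forall>a\<in>carr A. i (xstar X q b a) = binop E q (s b) (i a)"
    unfolding derived_actions_def by auto
  interpret E: gwo_object T E by fact
  have "split_extension T A B E (xdot X) (xstar X) i p s"
    by unfold_locales (use ips in auto)
  then show ?thesis by blast
qed

lemma action_closed:
  shows "b \<in> carr B \<Longrightarrow> a \<in> carr A \<Longrightarrow> xdot X b a \<in> carr A"
    and "q \<in> binops T \<Longrightarrow> b \<in> carr B \<Longrightarrow> a \<in> carr A \<Longrightarrow> xstar X q b a \<in> carr A"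
proof -
  from split_extension_exists obtain E :: "('a \<times> 'a, 'p, 'q) gwo" and i p s
    where "split_extension T A B E (xdot X) (xstar X) i p s" by blast
  then interpret ext: split_extension T A B E "xdot X" "xstar X" i p s .
  show "b \<in> carr B \<Longrightarrow> a \<in> carr A \<Longrightarrow> xdot X b a \<in> carr A"
    and "q \<in> binops T \<Longrightarrow> b \<in> carr B \<Longrightarrow> a \<in> carr A \<Longrightarrow> xstar X q b a \<in> carr A"
    by (fact ext.dot_closed, fact ext.star_closed)
qed

lemma action_zero:
  shows "a \<in> carr A \<Longrightarrow> xdot X \<zero>\<^bsub>B\<^esub> a = a"
    and "b \<in> carr B \<Longrightarrow> xdot X b \<zero>\<^bsub>A\<^esub> = \<zero>\<^bsub>A\<^esub>"
    and "q \<in> binops T \<Longrightarrow> a \<in> carr A \<Longrightarrow> xstar X q \<zero>\<^bsub>B\<^esub> a = \<zero>\<^bsub>A\<^esub>"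
    and "q \<in> binops T \<Longrightarrow> b \<in> carr B \<Longrightarrow> xstar X q b \<zero>\<^bsub>A\<^esub> = \<zero>\<^bsub>A\<^esub>"
proof -
  from split_extension_exists obtain E :: "('a \<times> 'a, 'p, 'q) gwo" and i p s
    where "split_extension T A B E (xdot X) (xstar X) i p s" by blast
  then interpret ext: split_extension T A B E "xdot X" "xstar X" i p s .
  show "a \<in> carr A \<Longrightarrow> xdot X \<zero>\<^bsub>B\<^esub> a = a"
    and "b \<in> carr B \<Longrightarrow> xdot X b \<zero>\<^bsub>A\<^esub> = \<zero>\<^bsub>A\<^esub>"
    and "q \<in> binops T \<Longrightarrow> a \<in> carr A \<Longrightarrow> xstar X q \<zero>\<^bsub>B\<^esub> a = \<zero>\<^bsub>A\<^esub>"
    and "q \<in> binops T \<Longrightarrow> b \<in> carr B \<Longrightarrow> xstar X q b \<zero>\<^bsub>A\<^esub> = \<zero>\<^bsub>A\<^esub>"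
    by (fact ext.dot_zero_left, fact ext.dot_zero_right, fact ext.star_zero_left, fact ext.star_zero_right)
qed

lemma semidirect_object: "gwo_object T S"
  using split_extension_exists split_extension.semidirect_object by blast

lemmas map_simps =
  crossed_module.map_dot[OF xmod] crossed_module.map_star_left[OF xmod] crossed_module.map_star_right[OF xmod]
  gwo_homD[OF crossed_module.map_hom[OF xmod]]
  gwo_hom_zero[OF A.gwo_algebra_axioms B.gwo_algebra_axioms crossed_module.map_hom[OF xmod]]
  gwo_hom_neg[OF A.gwo_algebra_axioms B.gwo_algebra_axioms crossed_module.map_hom[OF xmod]]

lemmas closure = A.closed B.closed action_closed opp_closed gwo_homD(1)[OF crossed_module.map_hom[OF xmod]]

lemma cat1_sel:
  shows "cgrp (xmod_cat1 T X) = S"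
    and "csrc (xmod_cat1 T X) = restrict (\<lambda>(a, b). (\<zero>\<^bsub>A\<^esub>, b)) (carr A \<times> carr B)"
    and "ctgt (xmod_cat1 T X) = restrict (\<lambda>(a, b). (\<zero>\<^bsub>A\<^esub>, xmap X a \<oplus>\<^bsub>B\<^esub> b)) (carr A \<times> carr B)"
  by (simp_all add: xmod_cat1_def Let_def) (simp_all add: semidirect_def)

lemma S_sel:
  shows "carr S = carr A \<times> carr B" and "\<zero>\<^bsub>S\<^esub> = (\<zero>\<^bsub>A\<^esub>, \<zero>\<^bsub>B\<^esub>)"
    and "(a', b') \<oplus>\<^bsub>S\<^esub> (a, b) = (a' \<oplus>\<^bsub>A\<^esub> xdot X b' a, b' \<oplus>\<^bsub>B\<^esub> b)"
    and "unop S w (a, b) = (unop A w a, unop B w b)"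
    and "binop S q (a', b') (a, b) =
      (binop A q a' a \<oplus>\<^bsub>A\<^esub> xstar X (opp T q) b a' \<oplus>\<^bsub>A\<^esub> xstar X q b' a, binop B q b' b)"
  by (simp_all add: semidirect_def)

lemma ker_src_cat1: "ker_src (xmod_cat1 T X) = carr A \<times> {\<zero>\<^bsub>B\<^esub>}"
  by (auto simp: gwo_ker_def cat1_sel S_sel closure)

text \<open>The compatibility of $\alpha$ with the actions makes $t$ a morphism, and the Peiffer identities give
  the two kernel conditions.\<close>

lemma cat1_group: "cat1_group T (xmod_cat1 T X)"
proof (rule cat1_group.intro, unfold ker_src_cat1)
  show "gwo_object T (cgrp (xmod_cat1 T X))" by (simp add: cat1_sel semidirect_object)
  show "csrc (xmod_cat1 T X) \<in> gwo_hom T (cgrp (xmod_cat1 T X)) (cgrp (xmod_cat1 T X))"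
    by (auto simp: gwo_hom_def cat1_sel S_sel closure action_zero A.group_simps A.unop_zero A.binop_zero_left)
  show "ctgt (xmod_cat1 T X) \<in> gwo_hom T (cgrp (xmod_cat1 T X)) (cgrp (xmod_cat1 T X))"
    by (auto simp: gwo_hom_def cat1_sel S_sel closure action_zero A.group_simps A.unop_zero A.binop_zero_left
        map_simps B.group_simps B.unop_add B.distrib_both B.binop_opp)
next
  fix x assume "x \<in> carr (cgrp (xmod_cat1 T X))"
  then show "csrc (xmod_cat1 T X) (ctgt (xmod_cat1 T X) x) = ctgt (xmod_cat1 T X) x"
    and "ctgt (xmod_cat1 T X) (csrc (xmod_cat1 T X) x) = csrc (xmod_cat1 T X) x"
    by (auto simp: cat1_sel S_sel closure map_simps B.zero_add)
next
  fix x y assume x: "x \<in> carr A \<times> {\<zero>\<^bsub>B\<^esub>}" and y: "y \<in> ker_tgt (xmod_cat1 T X)"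
  obtain a where a: "x = (a, \<zero>\<^bsub>B\<^esub>)" "a \<in> carr A" using x by auto
  \<comment> \<open>An element of $\ker t$ has the form $(a', \alpha(-a'))$, so the Peiffer identities apply to it.\<close>
  obtain a' b' where a': "y = (a', b')" "a' \<in> carr A" "b' \<in> carr B" "xmap X a' \<oplus>\<^bsub>B\<^esub> b' = \<zero>\<^bsub>B\<^esub>"
    using y by (auto simp: gwo_ker_def cat1_sel S_sel)
  have b': "b' = xmap X (\<ominus>\<^bsub>A\<^esub> a')"
    using B.neg_unique[OF _ _ a'(4)] a' by (simp add: closure map_simps)
  show "x \<oplus>\<^bsub>cgrp (xmod_cat1 T X)\<^esub> y = y \<oplus>\<^bsub>cgrp (xmod_cat1 T X)\<^esub> x"
    using a a'(2,3)
    by (simp add: a'(1) cat1_sel S_sel action_zero B.group_simps closure)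
       (simp add: b' crossed_module.peiffer_dot[OF xmod] A.group_simps)
  show "binop (cgrp (xmod_cat1 T X)) q x y = \<zero>\<^bsub>cgrp (xmod_cat1 T X)\<^esub>" if q: "q \<in> binops T" for q
    using a a'(2,3) q
    by (simp add: a'(1) cat1_sel S_sel action_zero B.binop_zero_left closure)
       (simp add: b' crossed_module.peiffer_star[OF xmod] A.group_simps closure A.binop_opp A.binop_neg_right)
qed

end

lemma ker_object_carr: "carr (ker_object A B f) = gwo_ker A B f"
  by (simp add: ker_object_def)

lemma ker_object_object:
  assumes "gwo_algebra T A" "gwo_algebra T B" and f: "f \<in> gwo_hom T A B"
  shows "gwo_object T (ker_object A B f)"
proof -
  interpret A: gwo_algebra T A by fact
  interpret B: gwo_algebra T B by fact
  note f_simps = gwo_homD[OF f] gwo_hom_zero[OF assms] gwo_hom_neg[OF assms]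
  show ?thesis
    by (rule gwo_object_if_embedded[where B = A and f = "\<lambda>x. x"])
       (auto simp: ker_object_def gwo_ker_def f_simps A.closed B.neg_zero B.zero_add B.zero_closed
         B.unop_zero B.binop_zero_left A.groups_with_operations_axioms A.gwo_object_axioms)
qed

text \<open>Bijective morphisms of algebras are isomorphisms, so coverings are recognised on underlying
  sets. In this form they are easily composed with isomorphisms.\<close>

lemma cat1_covering_iff_bij:
  assumes "groups_with_operations T" and D: "cat1_group T D" and C: "cat1_group T C"
  shows "cat1_covering T D C k \<longleftrightarrow> k \<in> cat1_hom T D C \<and> bij_betw k (ker_src D) (ker_src C)"
proof -
  interpret D: gwo_algebra T "cgrp D"
    by (intro gwo_algebra.intro assms(1) cat1_group.object[OF D])
  interpret C: gwo_algebra T "cgrp C"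
    by (intro gwo_algebra.intro assms(1) cat1_group.object[OF C])
  let ?K = "\<lambda>C. ker_object (cgrp C) (cgrp C) (csrc C)"
  have K: "gwo_object T (?K D)"
    by (rule ker_object_object[OF D.gwo_algebra_axioms D.gwo_algebra_axioms cat1_group.src_hom[OF D]])
  have "restrict k (ker_src D) \<in> gwo_hom T (?K D) (?K C)" if k: "k \<in> cat1_hom T D C"
  proof -
    have hom: "k \<in> gwo_hom T (cgrp D) (cgrp C)"
      and src: "\<And>x. x \<in> carr (cgrp D) \<Longrightarrow> csrc C (k x) = k (csrc D x)"
      using k by (auto simp: cat1_hom_def)
    have K_ops: "gadd (?K E) = gadd (cgrp E)" "unop (?K E) = unop (cgrp E)" "binop (?K E) = binop (cgrp E)"
      for E :: "('c, 'a, 'b) cat1"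
      by (simp_all add: ker_object_def)
    have in_ker: "x \<in> ker_src D \<Longrightarrow> k x \<in> ker_src C" for x
      using gwo_homD(1)[OF hom] gwo_hom_zero[OF D.gwo_algebra_axioms C.gwo_algebra_axioms hom] src
      by (auto simp: gwo_ker_def)
    have "x \<in> carr (?K D) \<Longrightarrow> x \<in> carr (cgrp D)" for x
      by (simp add: ker_object_def gwo_ker_def)
    then show ?thesis
      using in_ker gwo_homD[OF hom] gwo_object.add_closed[OF K] gwo_object.unop_closed[OF K]
        gwo_object.binop_closed[OF K]
      by (auto simp: gwo_hom_def K_ops ker_object_carr)
  qed
  moreover have "bij_betw (restrict k (ker_src D)) (ker_src D) (ker_src C) \<longleftrightarrow> bij_betw k (ker_src D) (ker_src C)"
    by (rule bij_betw_cong) simp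
  ultimately show ?thesis
    unfolding cat1_covering_def gwo_iso_iff_bij[OF K] ker_object_carr by blast
qed

lemma xmod_homD:
  assumes "(f, g) \<in> xmod_hom T X Y"
  shows "f \<in> gwo_hom T (xdom X) (xdom Y)" and "g \<in> gwo_hom T (xcod X) (xcod Y)"
    and "a \<in> carr (xdom X) \<Longrightarrow> g (xmap X a) = xmap Y (f a)"
    and "b \<in> carr (xcod X) \<Longrightarrow> a \<in> carr (xdom X) \<Longrightarrow> f (xdot X b a) = xdot Y (g b) (f a)"
    and "q \<in> binops T \<Longrightarrow> b \<in> carr (xcod X) \<Longrightarrow> a \<in> carr (xdom X) \<Longrightarrow> f (xstar X q b a) = xstar Y q (g b) (f a)"
  using assms by (auto simp: xmod_hom_def)

definition semidirect_map :: "('a, 'p, 'q) xmod \<Rightarrow> ('a \<Rightarrow> 'a) \<times> ('a \<Rightarrow> 'a) \<Rightarrow> 'a \<times> 'a \<Rightarrow> 'a \<times> 'a" where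
  "semidirect_map X h = restrict (map_prod (fst h) (snd h)) (carr (xdom X) \<times> carr (xcod X))"

locale crossed_module_pair = X: gwo_crossed_module T X + Y: gwo_crossed_module T Y
  for T :: "('p, 'q) gwo_theory" and X Y :: "('a, 'p, 'q) xmod"
begin

lemma semidirect_map_hom:
  assumes h: "h \<in> xmod_hom T X Y"
  shows "semidirect_map X h \<in> cat1_hom T (xmod_cat1 T X) (xmod_cat1 T Y)"
proof -
  obtain f g where fg: "h = (f, g)" by (cases h)
  note hom = xmod_homD[OF h[unfolded fg]]
  note zero = gwo_hom_zero[OF X.A.gwo_algebra_axioms Y.A.gwo_algebra_axioms hom(1)]
  show ?thesis
    unfolding fg semidirect_map_def
    by (auto simp: cat1_hom_def gwo_hom_def X.cat1_sel Y.cat1_sel X.S_sel Y.S_sel X.closure Y.closure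
        gwo_homD[OF hom(1)] gwo_homD[OF hom(2)] hom(3-) zero)
qed

lemma semidirect_map_inj: "inj_on (semidirect_map X) (xmod_hom T X Y)"
proof (rule inj_onI, clarify)
  fix f g f' g' assume h: "(f, g) \<in> xmod_hom T X Y" "(f', g') \<in> xmod_hom T X Y"
    and eq: "semidirect_map X (f, g) = semidirect_map X (f', g')"
  have "f a = f' a \<and> g b = g' b" if "a \<in> carr (xdom X)" "b \<in> carr (xcod X)" for a b
    using fun_cong[OF eq, of "(a, b)"] that by (simp add: semidirect_map_def)
  then have "f a = f' a" "g b = g' b" if "a \<in> carr (xdom X)" "b \<in> carr (xcod X)" for a b
    using that X.A.zero_closed X.B.zero_closed by blast+
  then show "f = f' \<and> g = g'"
    using X.A.zero_closed X.B.zero_closed h[THEN xmod_homD(1), THEN gwo_hom_extensional]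
      h[THEN xmod_homD(2), THEN gwo_hom_extensional]
    by (blast intro: extensionalityI)
qed

text \<open>The components of $k$ are read off on $\ker s = A \times 0$ and on $\operatorname{im} s = 0 \times B$.
  Compatibility with $\alpha$ is $k\,t(a,0) = t\,k(a,0)$, and compatibility with the actions comes from
  $(0,b) + (a,0) = (b \cdot a, b)$ and $(0,b) \star (a,0) = (b \star a, 0)$.\<close>

lemma semidirect_map_surj:
  assumes k: "k \<in> cat1_hom T (xmod_cat1 T X) (xmod_cat1 T Y)"
  shows "\<exists>h\<in>xmod_hom T X Y. semidirect_map X h = k"
proof -
  have hom: "k \<in> gwo_hom T X.S Y.S" using k by (simp add: cat1_hom_def X.cat1_sel Y.cat1_sel)
  note k_simps = gwo_homD[OF hom]
  have k_src: "k (csrc (xmod_cat1 T X) x) = csrc (xmod_cat1 T Y) (k x)"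
    and k_tgt: "k (ctgt (xmod_cat1 T X) x) = ctgt (xmod_cat1 T Y) (k x)" if "x \<in> carr X.S" for x
    using k that by (auto simp: cat1_hom_def X.cat1_sel)
  have XS: "gwo_algebra T X.S" and YS: "gwo_algebra T Y.S"
    by (intro gwo_algebra.intro X.groups_with_operations_axioms X.semidirect_object Y.semidirect_object)+
  note k_zero = gwo_hom_zero[OF XS YS hom, unfolded X.S_sel Y.S_sel]
  define f where "f = restrict (\<lambda>a. fst (k (a, \<zero>\<^bsub>xcod X\<^esub>))) (carr (xdom X))"
  define g where "g = restrict (\<lambda>b. snd (k (\<zero>\<^bsub>xdom X\<^esub>, b))) (carr (xcod X))"
  have ka: "f a \<in> carr (xdom Y)" "k (a, \<zero>\<^bsub>xcod X\<^esub>) = (f a, \<zero>\<^bsub>xcod Y\<^esub>)" if a: "a \<in> carr (xdom X)" for a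
  proof -
    have S: "(a, \<zero>\<^bsub>xcod X\<^esub>) \<in> carr X.S" using a by (simp add: X.S_sel X.closure)
    obtain u v where uv: "k (a, \<zero>\<^bsub>xcod X\<^esub>) = (u, v)" "u \<in> carr (xdom Y)" "v \<in> carr (xcod Y)"
      using k_simps(1)[OF S] by (auto simp: Y.S_sel)
    have "v = \<zero>\<^bsub>xcod Y\<^esub>"
      using k_src[OF S] a uv by (simp add: X.cat1_sel Y.cat1_sel X.closure k_zero)
    then show "f a \<in> carr (xdom Y)" "k (a, \<zero>\<^bsub>xcod X\<^esub>) = (f a, \<zero>\<^bsub>xcod Y\<^esub>)"
      using a uv by (simp_all add: f_def)
  qed
  have kb: "g b \<in> carr (xcod Y)" "k (\<zero>\<^bsub>xdom X\<^esub>, b) = (\<zero>\<^bsub>xdom Y\<^esub>, g b)" if b: "b \<in> carr (xcod X)" for b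
  proof -
    have S: "(\<zero>\<^bsub>xdom X\<^esub>, b) \<in> carr X.S" using b by (simp add: X.S_sel X.closure)
    obtain u v where uv: "k (\<zero>\<^bsub>xdom X\<^esub>, b) = (u, v)" "u \<in> carr (xdom Y)" "v \<in> carr (xcod Y)"
      using k_simps(1)[OF S] by (auto simp: Y.S_sel)
    have "u = \<zero>\<^bsub>xdom Y\<^esub>"
      using k_src[OF S] b uv by (simp add: X.cat1_sel Y.cat1_sel X.closure)
    then show "g b \<in> carr (xcod Y)" "k (\<zero>\<^bsub>xdom X\<^esub>, b) = (\<zero>\<^bsub>xdom Y\<^esub>, g b)"
      using b uv by (simp_all add: g_def)
  qed
  have kab: "k (a, b) = (f a, g b)" if "a \<in> carr (xdom X)" "b \<in> carr (xcod X)" for a b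
    using k_simps(2)[of "(a, \<zero>\<^bsub>xcod X\<^esub>)" "(\<zero>\<^bsub>xdom X\<^esub>, b)"] that
    by (simp add: X.S_sel Y.S_sel X.closure ka kb X.action_zero Y.action_zero
        X.A.group_simps X.B.group_simps Y.A.group_simps Y.B.group_simps)
  have f0: "f \<zero>\<^bsub>xdom X\<^esub> = \<zero>\<^bsub>xdom Y\<^esub>"
    using ka(2)[OF X.A.zero_closed] k_zero by simp
  have "f \<in> gwo_hom T (xdom X) (xdom Y)"
    unfolding gwo_hom_def
  proof (intro CollectI conjI ballI)
    show "f \<in> carr (xdom X) \<rightarrow>\<^sub>E carr (xdom Y)" by (intro PiE_I) (simp add: ka, simp add: f_def)
  next
    fix x y assume "x \<in> carr (xdom X)" "y \<in> carr (xdom X)"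
    then show "f (x \<oplus>\<^bsub>xdom X\<^esub> y) = f x \<oplus>\<^bsub>xdom Y\<^esub> f y"
      using k_simps(2)[of "(x, \<zero>\<^bsub>xcod X\<^esub>)" "(y, \<zero>\<^bsub>xcod X\<^esub>)"]
      by (simp add: X.S_sel Y.S_sel X.closure Y.closure ka X.action_zero Y.action_zero X.B.zero_add Y.B.zero_add)
  next
    fix w x assume "w \<in> unops T" "x \<in> carr (xdom X)"
    then show "f (unop (xdom X) w x) = unop (xdom Y) w (f x)"
      using k_simps(3)[of w "(x, \<zero>\<^bsub>xcod X\<^esub>)"]
      by (simp add: X.S_sel Y.S_sel X.closure ka X.B.unop_zero)
  next
    fix q x y assume "q \<in> binops T" "x \<in> carr (xdom X)" "y \<in> carr (xdom X)"
    then show "f (binop (xdom X) q x y) = binop (xdom Y) q (f x) (f y)"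
      using k_simps(4)[of q "(x, \<zero>\<^bsub>xcod X\<^esub>)" "(y, \<zero>\<^bsub>xcod X\<^esub>)"]
      by (simp add: X.S_sel Y.S_sel X.closure Y.closure ka X.action_zero Y.action_zero
          X.B.binop_zero_left Y.B.binop_zero_left X.A.add_zero Y.A.add_zero)
  qed
  moreover have "g \<in> gwo_hom T (xcod X) (xcod Y)"
    unfolding gwo_hom_def
  proof (intro CollectI conjI ballI)
    show "g \<in> carr (xcod X) \<rightarrow>\<^sub>E carr (xcod Y)" by (intro PiE_I) (simp add: kb, simp add: g_def)
  next
    fix x y assume "x \<in> carr (xcod X)" "y \<in> carr (xcod X)"
    then show "g (x \<oplus>\<^bsub>xcod X\<^esub> y) = g x \<oplus>\<^bsub>xcod Y\<^esub> g y"
      using k_simps(2)[of "(\<zero>\<^bsub>xdom X\<^esub>, x)" "(\<zero>\<^bsub>xdom X\<^esub>, y)"]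
      by (simp add: X.S_sel Y.S_sel X.closure Y.closure kb X.action_zero Y.action_zero X.A.zero_add Y.A.zero_add)
  next
    fix w x assume "w \<in> unops T" "x \<in> carr (xcod X)"
    then show "g (unop (xcod X) w x) = unop (xcod Y) w (g x)"
      using k_simps(3)[of w "(\<zero>\<^bsub>xdom X\<^esub>, x)"]
      by (simp add: X.S_sel Y.S_sel X.closure kb X.A.unop_zero)
  next
    fix q x y assume "q \<in> binops T" "x \<in> carr (xcod X)" "y \<in> carr (xcod X)"
    then show "g (binop (xcod X) q x y) = binop (xcod Y) q (g x) (g y)"
      using k_simps(4)[of q "(\<zero>\<^bsub>xdom X\<^esub>, x)" "(\<zero>\<^bsub>xdom X\<^esub>, y)"]
      by (simp add: X.S_sel Y.S_sel X.closure Y.closure kb X.action_zero Y.action_zero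
          X.A.binop_zero_left Y.A.binop_zero_left X.A.add_zero Y.A.add_zero)
  qed
  moreover have "g (xmap X a) = xmap Y (f a)" if "a \<in> carr (xdom X)" for a
    using k_tgt[of "(a, \<zero>\<^bsub>xcod X\<^esub>)"] that
    by (simp add: X.S_sel X.cat1_sel Y.cat1_sel X.closure Y.closure ka kb X.B.add_zero Y.B.add_zero)
  moreover have "f (xdot X b a) = xdot Y (g b) (f a)" if "b \<in> carr (xcod X)" "a \<in> carr (xdom X)" for a b
    using k_simps(2)[of "(\<zero>\<^bsub>xdom X\<^esub>, b)" "(a, \<zero>\<^bsub>xcod X\<^esub>)"] that
    by (simp add: X.S_sel Y.S_sel X.closure Y.closure f0 ka kb kab X.A.zero_add Y.A.zero_add X.B.add_zero)
  moreover have "f (xstar X q b a) = xstar Y q (g b) (f a)"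
    if "q \<in> binops T" "b \<in> carr (xcod X)" "a \<in> carr (xdom X)" for q a b
    using k_simps(4)[of q "(\<zero>\<^bsub>xdom X\<^esub>, b)" "(a, \<zero>\<^bsub>xcod X\<^esub>)"] that
    by (simp add: X.S_sel Y.S_sel X.closure Y.closure ka kb X.action_zero Y.action_zero
        X.A.binop_zero_left Y.A.binop_zero_left X.B.binop_zero_right X.A.zero_add Y.A.zero_add)
  ultimately have "(f, g) \<in> xmod_hom T X Y" by (simp add: xmod_hom_def)
  moreover have "semidirect_map X (f, g) = k"
  proof
    fix x show "semidirect_map X (f, g) x = k x"
      using gwo_hom_extensional[OF hom]
      by (cases x) (auto simp: semidirect_map_def X.S_sel kab extensional_def)
  qed
  ultimately show ?thesis by blast
qed

text \<open>On $\ker s = A \times 0$ the map $f \times g$ is $f$.\<close>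

lemma semidirect_map_covering_iff:
  assumes h: "h \<in> xmod_hom T X Y"
  shows "cat1_covering T (xmod_cat1 T X) (xmod_cat1 T Y) (semidirect_map X h) \<longleftrightarrow> xmod_covering T X Y h"
proof -
  obtain f g where fg: "h = (f, g)" by (cases h)
  note hom = xmod_homD[OF h[unfolded fg]]
  have g0: "g \<zero>\<^bsub>xcod X\<^esub> = \<zero>\<^bsub>xcod Y\<^esub>"
    by (rule gwo_hom_zero[OF X.B.gwo_algebra_axioms Y.B.gwo_algebra_axioms hom(2)])
  have "bij_betw (semidirect_map X h) (carr (xdom X) \<times> {\<zero>\<^bsub>xcod X\<^esub>}) (carr (xdom Y) \<times> {\<zero>\<^bsub>xcod Y\<^esub>}) \<longleftrightarrow>
      bij_betw f (carr (xdom X)) (carr (xdom Y))"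
  proof -
    have img: "semidirect_map X h ` (carr (xdom X) \<times> {\<zero>\<^bsub>xcod X\<^esub>}) = (f ` carr (xdom X)) \<times> {\<zero>\<^bsub>xcod Y\<^esub>}"
      by (force simp: fg semidirect_map_def g0 X.closure)
    have inj: "inj_on (semidirect_map X h) (carr (xdom X) \<times> {\<zero>\<^bsub>xcod X\<^esub>}) \<longleftrightarrow> inj_on f (carr (xdom X))"
      by (simp add: inj_on_def fg semidirect_map_def g0 X.closure)
    show ?thesis unfolding bij_betw_def img inj by (auto simp: times_eq_iff)
  qed
  then show ?thesis
    unfolding cat1_covering_iff_bij[OF X.groups_with_operations_axioms X.cat1_group Y.cat1_group]
      X.ker_src_cat1 Y.ker_src_cat1 xmod_covering_def gwo_iso_iff_bij[OF X.A.gwo_object_axioms]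
    using h semidirect_map_hom[OF h] hom(1) by (simp add: fg)
qed

end

section \<open>From cat$^1$-groups to crossed modules\<close>

lemma derived_actions_if_split_extension:
  fixes E :: "('a \<times> 'a, 'p, 'q) gwo" and A B :: "('a, 'p, 'q) gwo"
  assumes "split_extension T A B E dot star i p s"
  shows "derived_actions T A B dot star"
proof -
  interpret split_extension T A B E dot star i p s by fact
  have "p ` carr E = carr B"
    using gwo_homD(1)[OF p_hom] gwo_homD(1)[OF s_hom] ps by (auto simp: image_iff) metis
  then show ?thesis
    unfolding derived_actions_def
    using dot_closed star_closed E.gwo_object_axioms i_hom i_inj i_image p_hom s_hom ps i_dot i_star
    by (intro conjI ballI exI[of _ E] exI[of _ i] exI[of _ p] exI[of _ s]) auto
qed

text \<open>Arguments are pulled back along $j$, so for injective $j$ this is a copy of the subalgebra $S$ of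
  $G$ whose elements lie in the codomain of $j$.\<close>

definition transport :: "('e \<Rightarrow> 'a) \<Rightarrow> 'e set \<Rightarrow> ('e, 'p, 'q) gwo \<Rightarrow> ('a, 'p, 'q) gwo" where
  "transport j S G =
     \<lparr>carr = j ` S, gzero = j \<zero>\<^bsub>G\<^esub>,
      gneg = (\<lambda>x. j (\<ominus>\<^bsub>G\<^esub> inv j x)),
      gadd = (\<lambda>x y. j (inv j x \<oplus>\<^bsub>G\<^esub> inv j y)),
      unop = (\<lambda>w x. j (unop G w (inv j x))),
      binop = (\<lambda>q x y. j (binop G q (inv j x) (inv j y)))\<rparr>"

lemma transport_sel:
  shows "carr (transport j S G) = j ` S" and "\<zero>\<^bsub>transport j S G\<^esub> = j \<zero>\<^bsub>G\<^esub>"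
    and "\<ominus>\<^bsub>transport j S G\<^esub> x = j (\<ominus>\<^bsub>G\<^esub> inv j x)"
    and "x \<oplus>\<^bsub>transport j S G\<^esub> y = j (inv j x \<oplus>\<^bsub>G\<^esub> inv j y)"
    and "unop (transport j S G) w x = j (unop G w (inv j x))"
    and "binop (transport j S G) q x y = j (binop G q (inv j x) (inv j y))"
  by (simp_all add: transport_def)

lemma transport_object:
  assumes "groups_with_operations T" and "gwo_object T G" and j: "inj j" and "S \<subseteq> carr G"
    and "\<zero>\<^bsub>G\<^esub> \<in> S" and "\<And>x. x \<in> S \<Longrightarrow> \<ominus>\<^bsub>G\<^esub> x \<in> S"
    and "\<And>x y. x \<in> S \<Longrightarrow> y \<in> S \<Longrightarrow> x \<oplus>\<^bsub>G\<^esub> y \<in> S"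
    and "\<And>w x. w \<in> unops T \<Longrightarrow> x \<in> S \<Longrightarrow> unop G w x \<in> S"
    and "\<And>q x y. q \<in> binops T \<Longrightarrow> x \<in> S \<Longrightarrow> y \<in> S \<Longrightarrow> binop G q x y \<in> S"
  shows "gwo_object T (transport j S G)"
  by (rule gwo_object_if_embedded[where B = G and f = "inv j"])
     (use assms in \<open>auto simp: transport_sel inv_f_f[OF j] inj_on_def\<close>)

text \<open>The crossed module $t : \ker s \to \operatorname{im} s$ with actions by conjugation and by the
  operations of $G$, relabelled along $j$.\<close>

definition cat1_xmod :: "('e \<Rightarrow> 'a) \<Rightarrow> ('e, 'p, 'q) cat1 \<Rightarrow> ('a, 'p, 'q) xmod" where
  "cat1_xmod j C =
     \<lparr>xdom = transport j (ker_src C) (cgrp C),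
      xcod = transport j (csrc C ` carr (cgrp C)) (cgrp C),
      xdot = (\<lambda>b a. j (inv j b \<oplus>\<^bsub>cgrp C\<^esub> inv j a \<oplus>\<^bsub>cgrp C\<^esub> (\<ominus>\<^bsub>cgrp C\<^esub> inv j b))),
      xstar = (\<lambda>q b a. j (binop (cgrp C) q (inv j b) (inv j a))),
      xmap = restrict (\<lambda>x. j (ctgt C (inv j x))) (j ` ker_src C)\<rparr>"

locale gwo_cat1_group = groups_with_operations T
  for T :: "('p, 'q) gwo_theory" +
  fixes C :: "('e, 'p, 'q) cat1"
  assumes cat1: "cat1_group T C"
begin

abbreviation "G \<equiv> cgrp C"
abbreviation "s \<equiv> csrc C"
abbreviation "t \<equiv> ctgt C"
abbreviation "R \<equiv> csrc C ` carr (cgrp C)"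

sublocale G: gwo_algebra T G
  by (intro gwo_algebra.intro groups_with_operations_axioms cat1_group.object[OF cat1])

lemmas src_hom = cat1_group.src_hom[OF cat1]
lemmas tgt_hom = cat1_group.tgt_hom[OF cat1]

lemmas src_simps = gwo_homD[OF src_hom] gwo_hom_zero[OF G.gwo_algebra_axioms G.gwo_algebra_axioms src_hom]
  gwo_hom_neg[OF G.gwo_algebra_axioms G.gwo_algebra_axioms src_hom]
lemmas tgt_simps = gwo_homD[OF tgt_hom] gwo_hom_zero[OF G.gwo_algebra_axioms G.gwo_algebra_axioms tgt_hom]
  gwo_hom_neg[OF G.gwo_algebra_axioms G.gwo_algebra_axioms tgt_hom]

lemma src_src: "x \<in> carr G \<Longrightarrow> s (s x) = s x"
  using cat1_group.src_tgt[OF cat1, of "s x"] cat1_group.tgt_src[OF cat1, of x] by (simp add: src_simps)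

lemma tgt_tgt: "x \<in> carr G \<Longrightarrow> t (t x) = t x"
  using cat1_group.tgt_src[OF cat1, of "t x"] cat1_group.src_tgt[OF cat1, of x] by (simp add: tgt_simps)

lemma src_image_iff: "x \<in> R \<longleftrightarrow> x \<in> carr G \<and> s x = x"
  by (auto simp: src_simps src_src intro: rev_image_eqI)

lemma src_image_closed:
  shows "\<zero>\<^bsub>G\<^esub> \<in> R" and "x \<in> R \<Longrightarrow> \<ominus>\<^bsub>G\<^esub> x \<in> R" and "x \<in> R \<Longrightarrow> y \<in> R \<Longrightarrow> x \<oplus>\<^bsub>G\<^esub> y \<in> R"
    and "w \<in> unops T \<Longrightarrow> x \<in> R \<Longrightarrow> unop G w x \<in> R"
    and "q \<in> binops T \<Longrightarrow> x \<in> R \<Longrightarrow> y \<in> R \<Longrightarrow> binop G q x y \<in> R"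
  by (simp_all only: src_image_iff src_simps G.closed)

lemma tgt_on_src_image: "x \<in> R \<Longrightarrow> t x = x"
  using cat1_group.tgt_src[OF cat1] by auto

lemma ker_src_iff: "x \<in> ker_src C \<longleftrightarrow> x \<in> carr G \<and> s x = \<zero>\<^bsub>G\<^esub>"
  by (simp add: gwo_ker_def)

lemma tgt_in_src_image: "x \<in> carr G \<Longrightarrow> t x \<in> R"
  by (simp add: src_image_iff tgt_simps cat1_group.src_tgt[OF cat1])

text \<open>The element $d = -a + t(a)$ lies in $\ker t$ and therefore commutes with $a' \in \ker s$. The sums are
  bracketed to the right because this is the normal form of \<open>group_simps\<close>.\<close>

lemma conj_by_tgt:
  assumes "a \<in> ker_src C" "a' \<in> ker_src C"
  shows "t a \<oplus>\<^bsub>G\<^esub> (a' \<oplus>\<^bsub>G\<^esub> (\<ominus>\<^bsub>G\<^esub> t a)) = a \<oplus>\<^bsub>G\<^esub> (a' \<oplus>\<^bsub>G\<^esub> (\<ominus>\<^bsub>G\<^esub> a))"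
proof -
  have c: "a \<in> carr G" "a' \<in> carr G" "t a \<in> carr G" using assms by (simp_all add: ker_src_iff tgt_simps)
  let ?d = "(\<ominus>\<^bsub>G\<^esub> a) \<oplus>\<^bsub>G\<^esub> t a"
  have "?d \<in> ker_tgt C" using c by (simp add: gwo_ker_def tgt_simps tgt_tgt G.group_simps)
  then have "a' \<oplus>\<^bsub>G\<^esub> ?d = ?d \<oplus>\<^bsub>G\<^esub> a'" by (rule cat1_group.ker_commute[OF cat1 assms(2)])
  then have "a \<oplus>\<^bsub>G\<^esub> (?d \<oplus>\<^bsub>G\<^esub> a') \<oplus>\<^bsub>G\<^esub> (\<ominus>\<^bsub>G\<^esub> t a) = a \<oplus>\<^bsub>G\<^esub> (a' \<oplus>\<^bsub>G\<^esub> ?d) \<oplus>\<^bsub>G\<^esub> (\<ominus>\<^bsub>G\<^esub> t a)" by simp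
  then show ?thesis using c by (simp add: G.group_simps)
qed

text \<open>Again $t(a) = a + d$ with $d = -a + t(a) \in \ker t$, and $d \star a' = a' \star^\circ d = 0$.\<close>

lemma star_by_tgt:
  assumes q: "q \<in> binops T" and "a \<in> ker_src C" "a' \<in> ker_src C"
  shows "binop G q (t a) a' = binop G q a a'"
proof -
  have c: "a \<in> carr G" "a' \<in> carr G" "t a \<in> carr G" using assms by (simp_all add: ker_src_iff tgt_simps)
  let ?d = "(\<ominus>\<^bsub>G\<^esub> a) \<oplus>\<^bsub>G\<^esub> t a"
  have "?d \<in> ker_tgt C" using c by (simp add: gwo_ker_def tgt_simps tgt_tgt G.group_simps)
  then have "binop G (opp T q) a' ?d = \<zero>\<^bsub>G\<^esub>"
    by (rule cat1_group.ker_star[OF cat1 opp_closed[OF q] assms(3)])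
  then have d: "binop G q ?d a' = \<zero>\<^bsub>G\<^esub>" using c q by (simp add: G.binop_opp G.closed)
  have "binop G q (t a) a' = binop G q (a \<oplus>\<^bsub>G\<^esub> ?d) a'" using c by (simp add: G.group_simps)
  also have "\<dots> = binop G q a a' \<oplus>\<^bsub>G\<^esub> binop G q ?d a'" using c q by (simp add: G.distrib_right G.closed)
  also have "\<dots> = binop G q a a'" using c q unfolding d by (simp add: G.group_simps)
  finally show ?thesis .
qed

text \<open>The group $G$ is itself a split extension of $\operatorname{im} s$ by $\ker s$: the projection is $s$ and the
  section is the inclusion of $\operatorname{im} s$.\<close>

lemma split_extension_transport:
  fixes j :: "'e \<Rightarrow> 'a"
  assumes j: "inj j"
  defines "Y \<equiv> cat1_xmod j C"
  shows "split_extension T (xdom Y) (xcod Y) G (xdot Y) (xstar Y)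
    (restrict (inv j) (j ` ker_src C)) (restrict (\<lambda>x. j (s x)) (carr G)) (restrict (inv j) (j ` R))"
proof -
  note jj = inv_f_f[OF j] inj_eq[OF j]
  have "gwo_object T (xdom Y)"
    unfolding Y_def cat1_xmod_def xmod.simps
    by (rule transport_object[OF groups_with_operations_axioms G.gwo_object_axioms j])
       (auto simp: ker_src_iff src_simps G.closed G.zero_add G.neg_zero G.unop_zero G.binop_zero_left)
  moreover have "gwo_object T (xcod Y)"
    unfolding Y_def cat1_xmod_def xmod.simps
    by (rule transport_object[OF groups_with_operations_axioms G.gwo_object_axioms j])
       (auto simp only: src_image_iff src_simps G.closed)
  ultimately show ?thesis
    by (intro split_extension.intro gwo_algebra.intro split_extension_axioms.intro
          groups_with_operations_axioms G.gwo_object_axioms)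
       (auto simp: Y_def cat1_xmod_def transport_sel gwo_hom_def gwo_ker_def jj image_inv_f_f[OF j]
         src_simps src_src G.group_simps G.unop_zero G.binop_zero_right
         intro!: imageI inj_onI src_image_closed)
qed

text \<open>That the actions are derived is a hypothesis here, because derived actions ask for a middle term
  on the square of the type of the crossed module, while $G$ may live on any type.\<close>

lemma crossed_module_cat1_xmod:
  fixes j :: "'e \<Rightarrow> 'a"
  assumes j: "inj j" and act: "derived_actions T (xdom (cat1_xmod j C)) (xcod (cat1_xmod j C))
    (xdot (cat1_xmod j C)) (xstar (cat1_xmod j C))"
  shows "crossed_module T (cat1_xmod j C)"
proof -
  interpret ext: split_extension T "xdom (cat1_xmod j C)" "xcod (cat1_xmod j C)" G
    "xdot (cat1_xmod j C)" "xstar (cat1_xmod j C)"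
    "restrict (inv j) (j ` ker_src C)" "restrict (\<lambda>x. j (s x)) (carr G)" "restrict (inv j) (j ` R)"
    by (rule split_extension_transport[OF j])
  note jj = inv_f_f[OF j] inj_eq[OF j]
  have ker: "j x \<in> j ` ker_src C \<longleftrightarrow> x \<in> ker_src C" for x using j by (rule inj_image_mem_iff)
  note sel = cat1_xmod_def transport_sel jj ker
  show ?thesis
  proof (rule crossed_module.intro[OF ext.A.gwo_object_axioms ext.B.gwo_object_axioms act])
    show "xmap (cat1_xmod j C) \<in> gwo_hom T (xdom (cat1_xmod j C)) (xcod (cat1_xmod j C))"
      by (auto simp: gwo_hom_def sel ker_src_iff src_simps tgt_simps tgt_in_src_image G.closed
        G.zero_add G.unop_zero G.binop_zero_left)
  qed (auto simp: sel ker_src_iff src_simps tgt_simps tgt_on_src_image G.closed src_src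
      conj_by_tgt star_by_tgt cat1_group.tgt_src[OF cat1] G.group_simps
      G.binop_zero_left G.binop_zero_right G.binop_opp)
qed

end

text \<open>The isomorphism is $(a,b) \mapsto a + b$. It respects source and target because $s$ kills $a$ while both
  $s$ and $t$ fix $b$.\<close>

theorem cat1_group_is_xmod_cat1:
  fixes C :: "('a \<times> 'a, 'p, 'q) cat1" and j :: "'a \<times> 'a \<Rightarrow> 'a"
  assumes gwo: "groups_with_operations T" and cat1: "cat1_group T C" and j: "inj j"
  defines "Y \<equiv> cat1_xmod j C"
  shows "crossed_module T Y"
    and "\<exists>k \<in> cat1_hom T (xmod_cat1 T Y) C. k \<in> gwo_iso T (cgrp (xmod_cat1 T Y)) (cgrp C)"
proof -
  interpret gwo_cat1_group T C
    by (intro gwo_cat1_group.intro gwo_cat1_group_axioms.intro gwo cat1)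
  interpret ext: split_extension T "xdom Y" "xcod Y" G "xdot Y" "xstar Y"
    "restrict (inv j) (j ` ker_src C)" "restrict (\<lambda>x. j (s x)) (carr G)" "restrict (inv j) (j ` R)"
    unfolding Y_def by (rule split_extension_transport[OF j])
  show xmod: "crossed_module T Y"
    unfolding Y_def
    by (rule crossed_module_cat1_xmod[OF j])
       (rule derived_actions_if_split_extension[OF split_extension_transport[OF j]])
  interpret Y: gwo_crossed_module T Y
    by (intro gwo_crossed_module.intro gwo_crossed_module_axioms.intro gwo xmod)
  have ker: "j x \<in> j ` ker_src C \<longleftrightarrow> x \<in> ker_src C" for x using j by (rule inj_image_mem_iff)
  have R: "j x \<in> j ` R \<longleftrightarrow> x \<in> R" for x using j by (rule inj_image_mem_iff)
  note sel = Y_def cat1_xmod_def transport_sel inv_f_f[OF j] inj_eq[OF j] ker R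
  have YA: "carr (xdom Y) = j ` ker_src C" "\<zero>\<^bsub>xdom Y\<^esub> = j \<zero>\<^bsub>G\<^esub>" and YB: "carr (xcod Y) = j ` R"
    by (simp_all add: sel)
  have split_sum: "ext.split_sum (j a, j b) = a \<oplus>\<^bsub>G\<^esub> b" if "a \<in> ker_src C" "b \<in> R" for a b
    using that by (simp add: ext.split_sum_apply YA YB ker R inv_f_f[OF j])
  have zero: "\<zero>\<^bsub>G\<^esub> \<in> ker_src C" by (simp add: ker_src_iff src_simps G.closed)
  have src: "csrc (xmod_cat1 T Y) (j a, j b) = (j \<zero>\<^bsub>G\<^esub>, j b)"
    and tgt: "ctgt (xmod_cat1 T Y) (j a, j b) = (j \<zero>\<^bsub>G\<^esub>, j (t a \<oplus>\<^bsub>G\<^esub> b))"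
    if "a \<in> ker_src C" "b \<in> R" for a b
    using that by (simp_all add: Y.cat1_sel YA YB ker R) (simp_all add: sel)
  have "ext.split_sum \<in> cat1_hom T (xmod_cat1 T Y) C"
    unfolding cat1_hom_def
  proof (intro CollectI conjI ballI)
    show "ext.split_sum \<in> gwo_hom T (cgrp (xmod_cat1 T Y)) (cgrp C)"
      using ext.split_sum_iso by (simp add: Y.cat1_sel gwo_iso_def)
  next
    fix x assume "x \<in> carr (cgrp (xmod_cat1 T Y))"
    then obtain a b where x: "x = (j a, j b)" and a: "a \<in> ker_src C" and b: "b \<in> R"
      unfolding Y.cat1_sel Y.S_sel YA YB by blast
    have ac: "a \<in> carr G" "s a = \<zero>\<^bsub>G\<^esub>" and bc: "b \<in> carr G" "s b = b" "t b = b"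
      using a b src_image_iff[of b] tgt_on_src_image[OF b] by (auto simp: ker_src_iff)
    show "ext.split_sum (csrc (xmod_cat1 T Y) x) = s (ext.split_sum x)"
      using ac bc by (simp add: x src[OF a b] split_sum[OF zero b] split_sum[OF a b] src_simps)
    have tb: "t a \<oplus>\<^bsub>G\<^esub> b \<in> R" by (intro src_image_closed tgt_in_src_image ac b)
    show "ext.split_sum (ctgt (xmod_cat1 T Y) x) = t (ext.split_sum x)"
      using ac bc by (simp add: x tgt[OF a b] split_sum[OF zero tb] split_sum[OF a b] tgt_simps G.group_simps)
  qed
  then show "\<exists>k \<in> cat1_hom T (xmod_cat1 T Y) C. k \<in> gwo_iso T (cgrp (xmod_cat1 T Y)) (cgrp C)"
    using ext.split_sum_iso by (auto simp: Y.cat1_sel)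
qed

section \<open>The equivalence\<close>

lemma cat1_cat_category:
  fixes T :: "('p, 'q) gwo_theory"
  shows "is_category (cat1_cat T :: (('a, 'p, 'q) cat1, _) cat)"
proof
  fix C :: "('a, 'p, 'q) cat1" assume "C \<in> Ob (cat1_cat T)"
  then have C: "cat1_group T C" by (simp add: cat1_cat_def)
  show "Ident (cat1_cat T) C \<in> Hom (cat1_cat T) C C"
    using gwo_hom_ident[OF cat1_group.object[OF C]] gwo_homD(1)[OF cat1_group.src_hom[OF C]]
      gwo_homD(1)[OF cat1_group.tgt_hom[OF C]]
    by (simp add: cat1_cat_def cat1_hom_def)
next
  fix C D E :: "('a, 'p, 'q) cat1" and f g
  assume "C \<in> Ob (cat1_cat T)" and fg: "f \<in> Hom (cat1_cat T) C D" "g \<in> Hom (cat1_cat T) D E"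
  then have C: "cat1_group T C" by (simp add: cat1_cat_def)
  have f: "f \<in> gwo_hom T (cgrp C) (cgrp D)" and g: "g \<in> gwo_hom T (cgrp D) (cgrp E)"
    using fg by (simp_all add: cat1_cat_def cat1_hom_def)
  show "Comp (cat1_cat T) C D E g f \<in> Hom (cat1_cat T) C E"
    using fg gwo_hom_compose[OF f g cat1_group.object[OF C]] gwo_homD(1)[OF cat1_group.src_hom[OF C]]
      gwo_homD(1)[OF cat1_group.tgt_hom[OF C]] gwo_homD(1)[OF f]
    by (simp add: cat1_cat_def cat1_hom_def compose_eq)
next
  fix C D :: "('a, 'p, 'q) cat1" and f
  assume "f \<in> Hom (cat1_cat T) C D"
  then have f: "f \<in> gwo_hom T (cgrp C) (cgrp D)" by (simp add: cat1_cat_def cat1_hom_def)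
  show "Comp (cat1_cat T) C C D f (Ident (cat1_cat T) C) = f"
    and "Comp (cat1_cat T) C D D (Ident (cat1_cat T) D) f = f"
    by (rule extensionalityI[OF _ gwo_hom_extensional[OF f]];
        simp add: cat1_cat_def compose_eq gwo_homD(1)[OF f])+
next
  fix C D E F :: "('a, 'p, 'q) cat1" and f g h
  assume "f \<in> Hom (cat1_cat T) C D"
  then have "f \<in> carr (cgrp C) \<rightarrow> carr (cgrp D)" by (auto simp: cat1_cat_def cat1_hom_def gwo_hom_def)
  then show "Comp (cat1_cat T) C D F (Comp (cat1_cat T) D E F h g) f =
      Comp (cat1_cat T) C E F h (Comp (cat1_cat T) C D E g f)"
    by (simp add: cat1_cat_def compose_assoc)
qed

lemma xmod_cat_category:
  fixes T :: "('p, 'q) gwo_theory"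
  assumes gwo: "groups_with_operations T"
  shows "is_category (xmod_cat T :: (('a, 'p, 'q) xmod, _) cat)"
proof
  fix X :: "('a, 'p, 'q) xmod" assume "X \<in> Ob (xmod_cat T)"
  then interpret gwo_crossed_module T X
    by (intro gwo_crossed_module.intro gwo_crossed_module_axioms.intro gwo) (simp add: xmod_cat_def)
  show "Ident (xmod_cat T) X \<in> Hom (xmod_cat T) X X"
    using gwo_hom_ident[OF A.gwo_object_axioms] gwo_hom_ident[OF B.gwo_object_axioms]
    by (simp add: xmod_cat_def xmod_hom_def closure)
next
  fix X Y Z :: "('a, 'p, 'q) xmod" and h k
  assume "X \<in> Ob (xmod_cat T)" and h: "h \<in> Hom (xmod_cat T) X Y" and k: "k \<in> Hom (xmod_cat T) Y Z"
  then interpret gwo_crossed_module T X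
    by (intro gwo_crossed_module.intro gwo_crossed_module_axioms.intro gwo) (simp add: xmod_cat_def)
  obtain f g f' g' where hk: "h = (f, g)" "k = (f', g')" by (cases h, cases k)
  have fg: "(f, g) \<in> xmod_hom T X Y" and fg': "(f', g') \<in> xmod_hom T Y Z"
    using h k by (simp_all add: hk xmod_cat_def)
  note fg = xmod_homD[OF fg] and fg' = xmod_homD[OF fg']
  show "Comp (xmod_cat T) X Y Z k h \<in> Hom (xmod_cat T) X Z"
    using gwo_hom_compose[OF fg(1) fg'(1) A.gwo_object_axioms] gwo_hom_compose[OF fg(2) fg'(2) B.gwo_object_axioms]
    by (simp add: hk xmod_cat_def xmod_hom_def closure compose_eq fg(3-) fg'(3-)
        gwo_homD(1)[OF fg(1)] gwo_homD(1)[OF fg(2)])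
next
  fix X Y :: "('a, 'p, 'q) xmod" and h
  assume h: "h \<in> Hom (xmod_cat T) X Y"
  obtain f g where fg: "h = (f, g)" by (cases h)
  have f: "f \<in> gwo_hom T (xdom X) (xdom Y)" and g: "g \<in> gwo_hom T (xcod X) (xcod Y)"
    using h by (auto simp: fg xmod_cat_def xmod_hom_def)
  have "compose (carr (xdom X)) f (restrict (\<lambda>x. x) (carr (xdom X))) = f"
    "compose (carr (xdom X)) (restrict (\<lambda>x. x) (carr (xdom Y))) f = f"
    by (rule extensionalityI[OF _ gwo_hom_extensional[OF f]]; simp add: compose_eq gwo_homD(1)[OF f])+
  moreover have "compose (carr (xcod X)) g (restrict (\<lambda>x. x) (carr (xcod X))) = g"
    "compose (carr (xcod X)) (restrict (\<lambda>x. x) (carr (xcod Y))) g = g"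
    by (rule extensionalityI[OF _ gwo_hom_extensional[OF g]]; simp add: compose_eq gwo_homD(1)[OF g])+
  ultimately show "Comp (xmod_cat T) X X Y h (Ident (xmod_cat T) X) = h"
    and "Comp (xmod_cat T) X Y Y (Ident (xmod_cat T) Y) h = h"
    by (simp_all add: fg xmod_cat_def)
next
  fix W X Y Z :: "('a, 'p, 'q) xmod" and h k l
  assume h: "h \<in> Hom (xmod_cat T) W X"
  obtain f g where fg: "h = (f, g)" by (cases h)
  have "f \<in> carr (xdom W) \<rightarrow> carr (xdom X)" "g \<in> carr (xcod W) \<rightarrow> carr (xcod X)"
    using h by (auto simp: fg xmod_cat_def xmod_hom_def gwo_hom_def)
  then show "Comp (xmod_cat T) W X Z (Comp (xmod_cat T) X Y Z l k) h =
      Comp (xmod_cat T) W Y Z l (Comp (xmod_cat T) W X Y k h)"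
    by (simp add: fg xmod_cat_def compose_assoc split: prod.split)
qed

definition xmod_cat1_functor ::
  "('p, 'q) gwo_theory \<Rightarrow> (('a, 'p, 'q) xmod, ('a \<Rightarrow> 'a) \<times> ('a \<Rightarrow> 'a),
     ('a \<times> 'a, 'p, 'q) cat1, 'a \<times> 'a \<Rightarrow> 'a \<times> 'a) cfunctor" where
  "xmod_cat1_functor T = \<lparr>fob = xmod_cat1 T, farr = (\<lambda>X Y. semidirect_map X)\<rparr>"

lemma xmod_cat1_functor:
  fixes T :: "('p, 'q) gwo_theory"
  assumes gwo: "groups_with_operations T"
  shows "is_functor (xmod_cat T) (cat1_cat T) (xmod_cat1_functor T :: (('a, 'p, 'q) xmod, _, _, _) cfunctor)"
proof
  fix X :: "('a, 'p, 'q) xmod" assume "X \<in> Ob (xmod_cat T)"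
  then interpret gwo_crossed_module T X
    by (intro gwo_crossed_module.intro gwo_crossed_module_axioms.intro gwo) (simp add: xmod_cat_def)
  show "fob (xmod_cat1_functor T) X \<in> Ob (cat1_cat T)"
    by (simp add: xmod_cat1_functor_def cat1_cat_def cat1_group)
  show "farr (xmod_cat1_functor T) X X (Ident (xmod_cat T) X) =
      Ident (cat1_cat T) (fob (xmod_cat1_functor T) X)"
    by (auto simp: xmod_cat1_functor_def cat1_cat_def xmod_cat_def semidirect_map_def cat1_sel S_sel)
next
  fix X Y :: "('a, 'p, 'q) xmod" and h
  assume "X \<in> Ob (xmod_cat T)" "Y \<in> Ob (xmod_cat T)" and h: "h \<in> Hom (xmod_cat T) X Y"
  then interpret crossed_module_pair T X Y
    by (intro crossed_module_pair.intro gwo_crossed_module.intro gwo_crossed_module_axioms.intro gwo)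
       (simp_all add: xmod_cat_def)
  show "farr (xmod_cat1_functor T) X Y h \<in>
      Hom (cat1_cat T) (fob (xmod_cat1_functor T) X) (fob (xmod_cat1_functor T) Y)"
    using h semidirect_map_hom by (simp add: xmod_cat1_functor_def cat1_cat_def xmod_cat_def)
next
  fix X Y Z :: "('a, 'p, 'q) xmod" and h k :: "('a \<Rightarrow> 'a) \<times> ('a \<Rightarrow> 'a)"
  assume "X \<in> Ob (xmod_cat T)" and h: "h \<in> Hom (xmod_cat T) X Y"
  then interpret gwo_crossed_module T X
    by (intro gwo_crossed_module.intro gwo_crossed_module_axioms.intro gwo) (simp add: xmod_cat_def)
  obtain f g f' g' where hk: "h = (f, g)" "k = (f', g')" by (cases h, cases k)
  have f: "f \<in> gwo_hom T (xdom X) (xdom Y)" and g: "g \<in> gwo_hom T (xcod X) (xcod Y)"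
    using h by (auto simp: hk xmod_cat_def xmod_hom_def)
  show "farr (xmod_cat1_functor T) X Z (Comp (xmod_cat T) X Y Z k h) =
      Comp (cat1_cat T) (fob (xmod_cat1_functor T) X) (fob (xmod_cat1_functor T) Y)
        (fob (xmod_cat1_functor T) Z) (farr (xmod_cat1_functor T) Y Z k) (farr (xmod_cat1_functor T) X Y h)"
    by (rule ext) (auto simp: hk xmod_cat1_functor_def cat1_cat_def xmod_cat_def semidirect_map_def cat1_sel S_sel
        compose_def gwo_homD(1)[OF f] gwo_homD(1)[OF g])
qed

lemma xmod_cat1_fully_faithful:
  fixes T :: "('p, 'q) gwo_theory"
  assumes gwo: "groups_with_operations T"
  shows "fully_faithful (xmod_cat T) (cat1_cat T) (xmod_cat1_functor T :: (('a, 'p, 'q) xmod, _, _, _) cfunctor)"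
  unfolding fully_faithful_def
proof (intro ballI)
  fix X Y :: "('a, 'p, 'q) xmod"
  assume "X \<in> Ob (xmod_cat T)" "Y \<in> Ob (xmod_cat T)"
  then interpret crossed_module_pair T X Y
    by (intro crossed_module_pair.intro gwo_crossed_module.intro gwo_crossed_module_axioms.intro gwo)
       (simp_all add: xmod_cat_def)
  have "bij_betw (semidirect_map X) (xmod_hom T X Y) (cat1_hom T (xmod_cat1 T X) (xmod_cat1 T Y))"
    unfolding bij_betw_def using semidirect_map_inj semidirect_map_hom semidirect_map_surj by blast
  then show "bij_betw (farr (xmod_cat1_functor T) X Y) (Hom (xmod_cat T) X Y)
      (Hom (cat1_cat T) (fob (xmod_cat1_functor T) X) (fob (xmod_cat1_functor T) Y))"
    by (simp add: xmod_cat1_functor_def xmod_cat_def cat1_cat_def)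
qed

text \<open>If $m$ is the inverse of $k$, then $m\,s = m\,s\,k\,m = m\,k\,s\,m = s\,m$, and likewise for $t$.\<close>

lemma cat1_iso_if_gwo_iso:
  assumes C: "cat1_group T C" and k: "k \<in> cat1_hom T C D" and iso: "k \<in> gwo_iso T (cgrp C) (cgrp D)"
  shows "k \<in> cat_iso (cat1_cat T) C D"
proof -
  obtain m where m: "m \<in> gwo_hom T (cgrp D) (cgrp C)"
    and mk: "\<And>x. x \<in> carr (cgrp C) \<Longrightarrow> m (k x) = x" and km: "\<And>y. y \<in> carr (cgrp D) \<Longrightarrow> k (m y) = y"
    using iso by (auto simp: gwo_iso_def)
  have kc: "k (csrc C x) = csrc D (k x)" "k (ctgt C x) = ctgt D (k x)" if "x \<in> carr (cgrp C)" for x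
    using k that by (auto simp: cat1_hom_def)
  have "m (csrc D y) = csrc C (m y) \<and> m (ctgt D y) = ctgt C (m y)" if y: "y \<in> carr (cgrp D)" for y
  proof -
    have my: "m y \<in> carr (cgrp C)" by (rule gwo_homD(1)[OF m y])
    have "m (k (csrc C (m y))) = csrc C (m y)" "m (k (ctgt C (m y))) = ctgt C (m y)"
      using my gwo_homD(1)[OF cat1_group.src_hom[OF C]] gwo_homD(1)[OF cat1_group.tgt_hom[OF C]]
      by (auto intro: mk)
    then show ?thesis by (simp add: kc[OF my] km[OF y])
  qed
  then have "m \<in> cat1_hom T D C" using m by (simp add: cat1_hom_def)
  then show ?thesis
    using k mk km by (auto simp: cat_iso_def cat1_cat_def compose_def intro!: bexI[of _ m])
qed

lemma inj_square_if_infinite: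
  assumes "infinite (UNIV :: 'a set)"
  shows "\<exists>j :: 'a \<times> 'a \<Rightarrow> 'a. inj j"
proof -
  obtain j :: "'a \<times> 'a \<Rightarrow> 'a" where "bij_betw j (UNIV \<times> UNIV) UNIV"
    using card_of_ordIso[THEN iffD2, OF card_of_Times_same_infinite[OF assms]] by blast
  then show ?thesis by (auto simp: bij_betw_def)
qed

lemma xmod_cat1_essentially_surjective:
  fixes T :: "('p, 'q) gwo_theory"
  assumes gwo: "groups_with_operations T" and inf: "infinite (UNIV :: 'a set)"
  shows "essentially_surjective (xmod_cat T :: (('a, 'p, 'q) xmod, _) cat) (cat1_cat T) (xmod_cat1_functor T)"
  unfolding essentially_surjective_def
proof
  fix C :: "('a \<times> 'a, 'p, 'q) cat1" assume "C \<in> Ob (cat1_cat T)"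
  then have C: "cat1_group T C" by (simp add: cat1_cat_def)
  obtain j :: "'a \<times> 'a \<Rightarrow> 'a" where j: "inj j" using inj_square_if_infinite[OF inf] ..
  let ?Y = "cat1_xmod j C"
  have Y: "crossed_module T ?Y" by (rule cat1_group_is_xmod_cat1(1)[OF gwo C j])
  interpret gwo_crossed_module T ?Y
    by (intro gwo_crossed_module.intro gwo_crossed_module_axioms.intro gwo Y)
  obtain k where "k \<in> cat1_hom T (xmod_cat1 T ?Y) C" "k \<in> gwo_iso T (cgrp (xmod_cat1 T ?Y)) (cgrp C)"
    using cat1_group_is_xmod_cat1(2)[OF gwo C j] by blast
  then have "k \<in> cat_iso (cat1_cat T) (xmod_cat1 T ?Y) C"
    by (intro cat1_iso_if_gwo_iso cat1_group)
  then show "\<exists>X\<in>Ob (xmod_cat T). cat_iso (cat1_cat T) (fob (xmod_cat1_functor T) X) C \<noteq> {}"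
    using Y by (auto simp: xmod_cat_def xmod_cat1_functor_def intro!: exI[of _ ?Y])
qed

text \<open>This is what makes a covering precomposed with an isomorphism a covering again.\<close>

lemma cat1_iso_ker_src:
  assumes gwo: "groups_with_operations T" and C: "cat1_group T C" and D: "cat1_group T D"
    and iso: "k \<in> cat_iso (cat1_cat T) C D"
  shows "bij_betw k (ker_src C) (ker_src D)"
proof -
  obtain m where k: "k \<in> cat1_hom T C D" and m: "m \<in> cat1_hom T D C"
    and mk: "compose (carr (cgrp C)) m k = restrict (\<lambda>x. x) (carr (cgrp C))"
    and km: "compose (carr (cgrp D)) k m = restrict (\<lambda>x. x) (carr (cgrp D))"
    using iso by (auto simp: cat_iso_def cat1_cat_def)
  have into: "h ` ker_src C' \<subseteq> ker_src D'"
    if "cat1_group T C'" "cat1_group T D'" "h \<in> cat1_hom T C' D'" for C' D' h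
  proof -
    have "gwo_algebra T (cgrp C')" "gwo_algebra T (cgrp D')"
      by (intro gwo_algebra.intro gwo cat1_group.object that)+
    moreover have hom: "h \<in> gwo_hom T (cgrp C') (cgrp D')"
      and src: "\<And>x. x \<in> carr (cgrp C') \<Longrightarrow> csrc D' (h x) = h (csrc C' x)"
      using that(3) by (auto simp: cat1_hom_def)
    ultimately show ?thesis
      using gwo_hom_zero[OF _ _ hom] gwo_homD(1)[OF hom] by (auto simp: gwo_ker_def)
  qed
  have "m (k x) = x" if "x \<in> carr (cgrp C)" for x using fun_cong[OF mk, of x] that by (simp add: compose_def)
  moreover have "k (m y) = y" if "y \<in> carr (cgrp D)" for y using fun_cong[OF km, of y] that by (simp add: compose_def)
  ultimately show ?thesis
    using into[OF C D k] into[OF D C m]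
    by (intro bij_betw_byWitness[where f' = m]) (auto simp: gwo_ker_def)
qed

theorem theorem7p3:
  fixes T :: "('p, 'q) gwo_theory" and X :: "('u, 'p, 'q) xmod"
  assumes "groups_with_operations T"
    and "infinite (UNIV :: 'u set)"
    and "crossed_module T X"
  shows "equivalent_categories (xmod_covering_cat T X) (cat1_covering_cat T (xmod_cat1 T X))"
proof -
  let ?F = "xmod_cat1_functor T :: (('u, 'p, 'q) xmod, _, _, _) cfunctor"
  have "equivalent_categories (covering_cat (xmod_cat T) (xmod_covering T) X)
      (covering_cat (cat1_cat T) (cat1_covering T) (fob ?F X))"
  proof (rule covering_cat_equivalence)
    show "is_category (xmod_cat T :: (('u, 'p, 'q) xmod, _) cat)"
      and "is_category (cat1_cat T :: (('u \<times> 'u, 'p, 'q) cat1, _) cat)"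
      and "is_functor (xmod_cat T) (cat1_cat T) ?F" and "fully_faithful (xmod_cat T) (cat1_cat T) ?F"
      and "essentially_surjective (xmod_cat T) (cat1_cat T) ?F"
      by (intro xmod_cat_category cat1_cat_category xmod_cat1_functor xmod_cat1_fully_faithful
          xmod_cat1_essentially_surjective assms)+
    show "X \<in> Ob (xmod_cat T)" using assms(3) by (simp add: xmod_cat_def)
  next
    fix Y :: "('u, 'p, 'q) xmod" and h
    assume "Y \<in> Ob (xmod_cat T)" and h: "h \<in> Hom (xmod_cat T) Y X"
    then interpret crossed_module_pair T Y X
      by (intro crossed_module_pair.intro gwo_crossed_module.intro gwo_crossed_module_axioms.intro assms)
         (simp_all add: xmod_cat_def)
    show "cat1_covering T (fob ?F Y) (fob ?F X) (farr ?F Y X h) \<longleftrightarrow> xmod_covering T Y X h"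
      using h semidirect_map_covering_iff by (simp add: xmod_cat_def xmod_cat1_functor_def)
  next
    fix C D :: "('u \<times> 'u, 'p, 'q) cat1" and k p
    assume CD: "C \<in> Ob (cat1_cat T)" "D \<in> Ob (cat1_cat T)"
      and k: "k \<in> cat_iso (cat1_cat T) C D" and p: "p \<in> Hom (cat1_cat T) D (fob ?F X)"
      and cov: "cat1_covering T D (fob ?F X) p"
    interpret X: gwo_crossed_module T X
      by (intro gwo_crossed_module.intro gwo_crossed_module_axioms.intro assms)
    have C: "cat1_group T C" and D: "cat1_group T D" using CD by (simp_all add: cat1_cat_def)
    have FX: "cat1_group T (fob ?F X)" by (simp add: xmod_cat1_functor_def X.cat1_group)
    have "bij_betw p (ker_src D) (ker_src (fob ?F X))"
      using cov unfolding cat1_covering_iff_bij[OF assms(1) D FX] by simp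
    then have "bij_betw (p \<circ> k) (ker_src C) (ker_src (fob ?F X))"
      by (rule bij_betw_trans[OF cat1_iso_ker_src[OF assms(1) C D k]])
    then have "bij_betw (Comp (cat1_cat T) C D (fob ?F X) p k) (ker_src C) (ker_src (fob ?F X))"
      by (rule bij_betw_cong[THEN iffD1, rotated]) (simp add: cat1_cat_def compose_def gwo_ker_def)
    moreover have "Comp (cat1_cat T) C D (fob ?F X) p k \<in> Hom (cat1_cat T) C (fob ?F X)"
      by (rule is_category.comp_hom[OF cat1_cat_category CD _ _ p])
         (use k FX in \<open>auto simp: cat_iso_def cat1_cat_def\<close>)
    ultimately show "cat1_covering T C (fob ?F X) (Comp (cat1_cat T) C D (fob ?F X) p k)"
      unfolding cat1_covering_iff_bij[OF assms(1) C FX] by (simp add: cat1_cat_def)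
  qed
  then show ?thesis
    by (simp add: xmod_covering_cat_def cat1_covering_cat_def xmod_cat1_functor_def)
qed

end
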